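(* Let $B=(B_t)_{t\ge 0}$ be a real-valued standard Brownian motion with $B_0=0$, and for $x\in\mathbb R$ let $\mathcal Z_x=\{t\ge0: B_t=x\}$. Almost surely, for all $x\in\mathbb R$, $\mathrm{Dim}_\mathrm{H}(\mathcal Z_x)=\tfrac12$.
   Context: Notation: $|A|$ is Lebesgue measure (length of an interval). Let $\mathcal S_n=[2^{n-1},2^n)$ for $n\ge1$. For $E\subset\mathbb R^+$, $\rho\ge0$ and $n\ge1$, let $$\nu^n_\rho(E)=\inf\Big\{\sum_{i=1}^m\Big(\frac{|Q_i|}{2^n}\Big)^\rho: Q_i\subset\mathcal S_n \text{ non-trivial intervals with integer endpoints},\ E\cap\mathcal S_n\subset\bigcup_{i=1}^m Q_i\Big\},$$ the infimum being over finite families. The macroscopic Hausdorff dimension is $\mathrm{Dim}_\mathrm{H}E=\inf\{\rho\ge0:\sum_{n\ge1}\nu^n_\rho(E)<\infty\}$. *)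

theory Defs
  imports "HOL-Probability.Probability"
begin

definition standard_BM :: "'a measure \<Rightarrow> (real \<Rightarrow> 'a \<Rightarrow> real) \<Rightarrow> bool" where
  "standard_BM M B \<longleftrightarrow>
     prob_space M \<and>
     (\<forall>t. B t \<in> borel_measurable M) \<and>
     (AE \<omega> in M. B 0 \<omega> = 0) \<and>
     (AE \<omega> in M. continuous_on {0..} (\<lambda>t. B t \<omega>)) \<and>
     (\<forall>s t. 0 \<le> s \<and> s < t \<longrightarrow>
        distributed M lborel (\<lambda>\<omega>. B t \<omega> - B s \<omega>) (normal_density 0 (sqrt (t - s)))) \<and>
     (\<forall>(ts :: nat \<Rightarrow> real) (n :: nat). (0 \<le> ts 0 \<and> (\<forall>i<n. ts i < ts (Suc i))) \<longrightarrow>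
        prob_space.indep_vars M (\<lambda>_. borel) (\<lambda>i \<omega>. B (ts (Suc i)) \<omega> - B (ts i) \<omega>) {..<n})"

definition shell :: "nat \<Rightarrow> real set" where
  "shell n = {2 ^ (n - 1) ..< 2 ^ n}"

definition macro_nu :: "nat \<Rightarrow> real \<Rightarrow> real set \<Rightarrow> real" where
  "macro_nu n \<rho> E = Inf { (\<Sum>(a,b)\<in>F. (real_of_int (b - a) / 2 ^ n) powr \<rho>) | F.
      finite F \<and>
      (\<forall>(a,b)\<in>F. a < b \<and> {real_of_int a ..< real_of_int b} \<subseteq> shell n) \<and>
      E \<inter> shell n \<subseteq> (\<Union>(a,b)\<in>F. {real_of_int a ..< real_of_int b}) }"

definition macro_DimH :: "real set \<Rightarrow> real" where
  "macro_DimH E = Inf { \<rho>. 0 \<le> \<rho> \<and> summable (\<lambda>n. macro_nu (Suc n) \<rho> E) }"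

end

theory Submission
  imports Defs
begin

text \<open>
  Only integer covers matter, so levels can be treated at unit resolution, and there are countably
  many unit cells \<open>[j, j + 1)\<close>; this is what makes all estimates uniform in the level.

  Upper bound: cover the level set in the \<open>n\<close>-th shell by the unit intervals \<open>[k, k + 1)\<close> that it
  meets. Unless the path oscillates by more than \<open>2 powr (n * \<epsilon>)\<close> during such an interval, which is
  very unlikely, \<open>B k\<close> is that close to \<open>[j, j + 1)\<close>, so the expected number of intervals is of order
  \<open>2 powr (n / 2 + n * \<epsilon>)\<close>.

  Lower bound: let \<open>k\<close> be marked if the path crosses \<open>[j, j + 1)\<close> during \<open>[k, k + 1)\<close> in a suitable
  way, and give it the weight \<open>k powr (- 1 / 2)\<close>. If \<open>\<mu> n\<close> is the total weight of the marked points
  of the \<open>n\<close>-th shell and \<open>I n\<close> is their \<open>\<rho>\<close>-energy, then \<open>(\<mu> n)\<^sup>2 \<le> \<nu> n * I n\<close>, whence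
  \<open>(\<Sum>n\<le>N. \<mu> n)\<^sup>2 \<le> (\<Sum>n\<le>N. \<nu> n) * (\<Sum>n\<le>N. I n)\<close>. The first sum has mean of order \<open>N\<close> and variance
  \<open>O(N)\<close>, and for \<open>\<rho> < 1 / 2\<close> the last one has mean \<open>O(N)\<close>, so \<open>\<Sum>n. \<nu> n\<close> diverges.
\<close>

subsection \<open>Integer covers\<close>

definition integer_cover :: "nat \<Rightarrow> real set \<Rightarrow> (int \<times> int) set \<Rightarrow> bool" where
  "integer_cover n E F \<longleftrightarrow> finite F \<and>
      (\<forall>(a,b)\<in>F. a < b \<and> {real_of_int a ..< real_of_int b} \<subseteq> shell n) \<and>
      E \<inter> shell n \<subseteq> (\<Union>(a,b)\<in>F. {real_of_int a ..< real_of_int b})"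

lemma shell_nonneg: "t \<in> shell n \<Longrightarrow> 0 \<le> t"
  unfolding shell_def atLeastLessThan_iff by (blast intro: order_trans[OF zero_le_power[of "2::real"] ] zero_le_numeral)

lemma macro_nu_eq:
  "macro_nu n \<rho> E = Inf {(\<Sum>(a,b)\<in>F. (real_of_int (b - a) / 2 ^ n) powr \<rho>) | F. integer_cover n E F}"
  unfolding macro_nu_def integer_cover_def ..

lemma cover_cost_nonneg: "0 \<le> (\<Sum>(a,b)\<in>F. (real_of_int (b - a) / 2 ^ n) powr \<rho>)"
  by (auto intro!: sum_nonneg)

lemma macro_nu_le:
  assumes "integer_cover n E F"
  shows "macro_nu n \<rho> E \<le> (\<Sum>(a,b)\<in>F. (real_of_int (b - a) / 2 ^ n) powr \<rho>)"
  unfolding macro_nu_eq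
  by (rule cInf_lower) (use assms cover_cost_nonneg in \<open>auto intro!: bdd_belowI[where m=0]\<close>)

text \<open>This cover keeps the set under the infimum in \<open>macro_nu\<close> nonempty, so that
  a common lower bound of all costs passes to \<open>macro_nu\<close>. For \<open>n = 0\<close> the
  truncated \<open>n - 1\<close> would make both endpoints 1.\<close>

lemma integer_cover_shell:
  assumes "n \<ge> 1"
  shows "integer_cover n E {(2 ^ (n - 1), 2 ^ n)}"
proof -
  have "(2::int) ^ (n - 1) < 2 ^ n"
    using assms by (intro power_strict_increasing) auto
  then show ?thesis
    by (auto simp: integer_cover_def shell_def)
qed

lemma macro_nu_ge:
  assumes "n \<ge> 1"
    and "\<And>F. integer_cover n E F \<Longrightarrow> c \<le> (\<Sum>(a,b)\<in>F. (real_of_int (b - a) / 2 ^ n) powr \<rho>)"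
  shows "c \<le> macro_nu n \<rho> E"
  unfolding macro_nu_eq
  by (rule cInf_greatest) (use integer_cover_shell[OF assms(1)] assms(2) in \<open>blast+\<close>)

lemma macro_nu_nonneg: "n \<ge> 1 \<Longrightarrow> 0 \<le> macro_nu n \<rho> E"
  by (intro macro_nu_ge cover_cost_nonneg)

text \<open>The shell begins and ends at integers, so the unit cells that meet \<open>E\<close> stay
  inside it and form an admissible cover.\<close>

lemma macro_nu_le_count:
  assumes n: "n \<ge> 1"
  shows "macro_nu n \<rho> E \<le>
    real (card {k\<in>{2 ^ (n - 1)..<2 ^ n}. E \<inter> {real k..<real k + 1} \<noteq> {}}) * (1 / 2 ^ n) powr \<rho>"
proof -
  define S where "S = {k\<in>{2 ^ (n - 1)..<2 ^ n::nat}. E \<inter> {real k..<real k + 1} \<noteq> {}}"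
  define F where "F = (\<lambda>k. (int k, int k + 1)) ` S"
  have "integer_cover n E F"
    unfolding integer_cover_def
  proof (intro conjI)
    show "finite F" unfolding F_def S_def by simp
    show "\<forall>(a, b)\<in>F. a < b \<and> {real_of_int a..<real_of_int b} \<subseteq> shell n"
    proof -
      have "{real k..<real k + 1} \<subseteq> shell n" if "k \<in> S" for k
      proof -
      from that have k: "2 ^ (n - 1) \<le> k" "k < 2 ^ n" by (auto simp: S_def)
      have "(2::real) ^ (n - 1) \<le> real k" using k(1) by (metis of_nat_le_iff of_nat_numeral of_nat_power)
      moreover have "real k + 1 \<le> 2 ^ n"
      proof -
        have "real (k + 1) \<le> real (2 ^ n)" using k(2) by (intro of_nat_mono) simp
        then show ?thesis by simp
      qed
      ultimately show ?thesis by (auto simp: shell_def simp del: of_nat_le_iff numeral_power_le_of_nat_cancel_iff of_nat_le_numeral_power_cancel_iff)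
      qed
      then show ?thesis by (auto simp: F_def)
    qed
    show "E \<inter> shell n \<subseteq> (\<Union>(a, b)\<in>F. {real_of_int a..<real_of_int b})"
    proof
      fix t assume t: "t \<in> E \<inter> shell n"
      then have t0: "2 ^ (n - 1) \<le> t" "t < 2 ^ n" by (auto simp: shell_def)
      define k where "k = nat \<lfloor>t\<rfloor>"
      have "0 \<le> t" using t0 by (meson order_trans zero_le_numeral zero_le_power)
      then have k: "real k \<le> t" "t < real k + 1" unfolding k_def by linarith+
      have "real (2 ^ (n - 1)) < real (k + 1)" using t0 k by simp
      then have "2 ^ (n - 1) \<le> k" unfolding of_nat_less_iff by linarith
      moreover have "real k < 2 ^ n" using t0(2) k(1) by (rule order.strict_trans1[rotated])
      then have "k < 2 ^ n" by simp
      ultimately have "k \<in> S" using t k by (auto simp: S_def)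
      then show "t \<in> (\<Union>(a, b)\<in>F. {real_of_int a..<real_of_int b})"
        using k by (auto simp: F_def intro!: bexI[of _ k])
    qed
  qed
  then have "macro_nu n \<rho> E \<le> (\<Sum>(a,b)\<in>F. (real_of_int (b - a) / 2 ^ n) powr \<rho>)"
    by (rule macro_nu_le)
  also have "\<dots> = (\<Sum>k\<in>S. (1 / 2 ^ n) powr \<rho>)"
    unfolding F_def by (subst sum.reindex) (auto simp: inj_on_def)
  finally show ?thesis unfolding S_def by simp
qed

text \<open>The energy method: Cauchy-Schwarz applied to the masses of the pieces of an integer cover.\<close>

lemma mass_squared_le_nu_energy:
  fixes w :: "nat \<Rightarrow> real"
  assumes n: "n \<ge> 1" and \<rho>: "0 \<le> \<sigma>" "\<sigma> \<le> \<rho>"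
    and P: "P \<subseteq> {2 ^ (n - 1)..<2 ^ n}" "\<And>k. k \<in> P \<Longrightarrow> E \<inter> {real k..<real k + 1} \<noteq> {}"
    and w: "\<And>k. 0 \<le> w k"
  shows "(\<Sum>k\<in>P. w k)\<^sup>2 \<le> macro_nu n \<sigma> E *
    (\<Sum>k\<in>P. \<Sum>l\<in>P. w k * w l * (2 ^ n / (\<bar>real k - real l\<bar> + 1)) powr \<rho>)"
proof -
  define e where "e k l = w k * w l * (2 ^ n / (\<bar>real k - real l\<bar> + 1)) powr \<rho>" for k l
  have finP: "finite P" using P(1) finite_subset by blast
  have e0: "0 \<le> e k l" for k l unfolding e_def using w by simp
  define I where "I = (\<Sum>k\<in>P. \<Sum>l\<in>P. e k l)"
  have I0: "0 \<le> I" unfolding I_def by (intro sum_nonneg e0)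
  have main: "(\<Sum>k\<in>P. w k)\<^sup>2 \<le> (\<Sum>(a,b)\<in>F. (real_of_int (b - a) / 2 ^ n) powr \<sigma>) * I"
    if F: "integer_cover n E F" for F
  proof -
    have finF: "finite F" using F by (auto simp: integer_cover_def)
    \<comment> \<open>An interval of the cover that contains a point \<open>t\<close> of the cell of
      \<open>k\<close> contains \<open>k\<close> itself, because its endpoints are integers.
      Choosing one interval \<open>q k\<close> for every \<open>k\<close> turns the cover into a
      partition of \<open>P\<close>.\<close>
    have "\<exists>Q\<in>F. fst Q \<le> int k \<and> int k < snd Q" if k: "k \<in> P" for k
    proof -
      obtain t where t: "t \<in> E" "real k \<le> t" "t < real k + 1" using P(2)[OF k] by auto
      have k2: "2 ^ (n - 1) \<le> k" "k + 1 \<le> 2 ^ n" using P(1) k by auto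
      have "(2::real) ^ (n - 1) \<le> real k" using k2(1) by (metis of_nat_le_iff of_nat_numeral of_nat_power)
      then have "2 ^ (n - 1) \<le> t" using t(2) by (rule order_trans)
      moreover have "real (k + 1) \<le> real (2 ^ n)" using k2(2) by (intro of_nat_mono)
      with t(3) have "t < 2 ^ n" by simp
      ultimately have "t \<in> E \<inter> shell n" using t(1) by (simp add: shell_def)
      then obtain a b where "(a,b) \<in> F" "real_of_int a \<le> t" "t < real_of_int b"
        using F by (fastforce simp: integer_cover_def)
      moreover from this t have "a \<le> int k" "int k < b" by linarith+
      ultimately show ?thesis by force
    qed
    then obtain q where q: "\<And>k. k \<in> P \<Longrightarrow> q k \<in> F \<and> fst (q k) \<le> int k \<and> int k < snd (q k)"
      by metis
    define x where "x Q = (real_of_int (snd Q - fst Q) / 2 ^ n) powr \<sigma>" for Q :: "int \<times> int"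
    define PQ where "PQ Q = {k\<in>P. q k = Q}" for Q
    have fPQ: "finite (PQ Q)" for Q unfolding PQ_def using finP by simp
    define J where "J Q = (\<Sum>k\<in>PQ Q. \<Sum>l\<in>PQ Q. e k l)" for Q
    have J0: "0 \<le> J Q" for Q unfolding J_def by (intro sum_nonneg e0)
    have x0: "0 \<le> x Q" for Q unfolding x_def by simp
    have piece: "(\<Sum>k\<in>PQ Q. w k)\<^sup>2 \<le> x Q * J Q" if Q: "Q \<in> F" for Q
    proof -
      obtain a b where ab: "Q = (a, b)" by (cases Q)
      then have "a < b" and sub: "{real_of_int a..<real_of_int b} \<subseteq> shell n"
        using F Q by (auto simp: integer_cover_def)
      have ain: "real_of_int a \<in> shell n" using \<open>a < b\<close> by (intro subsetD[OF sub]) auto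
      have "0 \<le> real_of_int a" by (rule shell_nonneg[OF ain])
      have "real_of_int (b - 1) \<in> shell n" using \<open>a < b\<close> by (intro subsetD[OF sub]) auto
      then have "real_of_int b - 1 < 2 ^ n" by (simp add: shell_def)
      then have "real_of_int (b - 1) < real_of_int (2 ^ n)" by simp
      then have "b \<le> 2 ^ n" unfolding of_int_less_iff by linarith
      then have "b - a \<le> 2 ^ n" using \<open>0 \<le> real_of_int a\<close> by simp
      then have len: "real_of_int (b - a) \<le> 2 ^ n" by (metis of_int_le_iff of_int_numeral of_int_power)
      \<comment> \<open>Within one piece the distance plus one is at most the length of
        \<open>Q\<close>, so the kernel is at least \<open>(1 / y) powr \<rho>\<close> for the
        relative length \<open>y\<close>. As \<open>y \<le> 1\<close>, the cost may carry the
        smaller exponent \<open>\<sigma>\<close>. Two exponents are kept because the energy is later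
        controlled, almost surely, for countably many \<open>\<rho>\<close>.\<close>
      have one: "1 \<le> x Q * (2 ^ n / (\<bar>real k - real l\<bar> + 1)) powr \<rho>" if "k \<in> PQ Q" "l \<in> PQ Q" for k l
      proof -
        have "a \<le> int k" "int k < b" "a \<le> int l" "int l < b"
          using that q ab by (fastforce simp: PQ_def)+
        then have d: "\<bar>real k - real l\<bar> + 1 \<le> real_of_int (b - a)" by linarith
        define y where "y = real_of_int (b - a) / 2 ^ n"
        have y: "0 < y" "y \<le> 1" using \<open>a < b\<close> len by (auto simp: y_def)
        have "1 = y powr \<rho> * (1 / y) powr \<rho>" using y by (simp add: powr_divide)
        also have "\<dots> \<le> y powr \<sigma> * (2 ^ n / (\<bar>real k - real l\<bar> + 1)) powr \<rho>"
        proof (intro mult_mono powr_mono' powr_mono2)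
          have "1 / y = 2 ^ n / real_of_int (b - a)" by (simp add: y_def)
          also have "\<dots> \<le> 2 ^ n / (\<bar>real k - real l\<bar> + 1)"
            by (rule divide_left_mono[OF d]) (use \<open>a < b\<close> in \<open>auto intro!: mult_pos_pos\<close>)
          finally show "1 / y \<le> 2 ^ n / (\<bar>real k - real l\<bar> + 1)" .
        qed (use y \<rho> in auto)
        finally show ?thesis by (simp add: x_def ab y_def)
      qed
      have "(\<Sum>k\<in>PQ Q. w k)\<^sup>2 = (\<Sum>k\<in>PQ Q. \<Sum>l\<in>PQ Q. w k * w l)"
        by (simp add: power2_eq_square sum_product)
      also have "\<dots> \<le> (\<Sum>k\<in>PQ Q. \<Sum>l\<in>PQ Q. x Q * e k l)"
      proof (intro sum_mono)
        fix k l assume "k \<in> PQ Q" "l \<in> PQ Q"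
        then have "(w k * w l) * 1 \<le> (w k * w l) * (x Q * (2 ^ n / (\<bar>real k - real l\<bar> + 1)) powr \<rho>)"
          by (intro mult_left_mono one) (auto simp: w)
        then show "w k * w l \<le> x Q * e k l" by (simp add: e_def ac_simps)
      qed
      also have "\<dots> = x Q * J Q" by (simp add: J_def sum_distrib_left)
      finally show ?thesis .
    qed
    have "(\<Sum>k\<in>P. w k) = (\<Sum>Q\<in>F. \<Sum>k\<in>PQ Q. w k)"
      unfolding PQ_def using q by (intro sum.group[symmetric] finP finF) auto
    also have "\<dots> \<le> (\<Sum>Q\<in>F. sqrt (x Q) * sqrt (J Q))"
    proof (intro sum_mono)
      fix Q assume "Q \<in> F"
      then have "sqrt ((\<Sum>k\<in>PQ Q. w k)\<^sup>2) \<le> sqrt (x Q * J Q)" by (intro real_sqrt_le_mono piece)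
      then show "(\<Sum>k\<in>PQ Q. w k) \<le> sqrt (x Q) * sqrt (J Q)"
        by (simp add: real_sqrt_mult sum_nonneg w)
    qed
    finally have "(\<Sum>k\<in>P. w k)\<^sup>2 \<le> (\<Sum>Q\<in>F. sqrt (x Q) * sqrt (J Q))\<^sup>2"
      by (intro power_mono sum_nonneg w)
    also have "\<dots> \<le> (\<Sum>Q\<in>F. (sqrt (x Q))\<^sup>2) * (\<Sum>Q\<in>F. (sqrt (J Q))\<^sup>2)"
      by (rule Cauchy_Schwarz_ineq_sum)
    also have "\<dots> = (\<Sum>Q\<in>F. x Q) * (\<Sum>Q\<in>F. J Q)" by (simp add: x0 J0)
    also have "\<dots> \<le> (\<Sum>Q\<in>F. x Q) * I"
    proof (intro mult_left_mono sum_nonneg x0)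
      have "(\<Sum>Q\<in>F. J Q) \<le> (\<Sum>Q\<in>F. \<Sum>k\<in>PQ Q. \<Sum>l\<in>P. e k l)"
        unfolding J_def by (intro sum_mono sum_mono2 finP) (auto simp: PQ_def e0)
      also have "\<dots> = I"
        unfolding PQ_def I_def using q by (intro sum.group finP finF) auto
      finally show "(\<Sum>Q\<in>F. J Q) \<le> I" .
    qed
    finally show ?thesis by (simp add: x_def case_prod_unfold)
  qed
  show ?thesis
  \<comment> \<open>The infimum is reached after dividing by \<open>I\<close>. If
    \<open>I = 0\<close>, the bound for the cover by the whole shell already forces the mass to
    vanish.\<close>
  proof (cases "I = 0")
    case True
    then have "(\<Sum>k\<in>P. w k)\<^sup>2 \<le> 0" using main[OF integer_cover_shell[OF n]] by simp
    then show ?thesis using True by (simp add: I_def e_def)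
  next
    case False
    with I0 have "0 < I" by simp
    then have "(\<Sum>k\<in>P. w k)\<^sup>2 / I \<le> macro_nu n \<sigma> E"
      using main by (intro macro_nu_ge n) (simp add: divide_le_eq)
    then have "(\<Sum>k\<in>P. w k)\<^sup>2 \<le> macro_nu n \<sigma> E * I" using \<open>0 < I\<close> by (simp add: divide_le_eq)
    then show ?thesis by (simp add: I_def e_def)
  qed
qed

section \<open>A criterion for the dimension, dyadic chaining, and two elementary sums\<close>

lemma macro_DimH_eqI:
  assumes "0 < d"
    and up: "\<And>m. summable (\<lambda>n. macro_nu (Suc n) (d + 1 / real (Suc m)) E)"
    and low: "\<And>\<rho>. 0 \<le> \<rho> \<Longrightarrow> \<rho> < d \<Longrightarrow> \<not> summable (\<lambda>n. macro_nu (Suc n) \<rho> E)"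
  shows "macro_DimH E = d"
proof (rule antisym)
  \<comment> \<open>A sequence of exponents decreasing to \<open>d\<close> determines the upper
    bound, so only countably many almost sure statements will have to be intersected.\<close>
  have "macro_DimH E \<le> d + 1 / real (Suc m)" for m
    unfolding macro_DimH_def using up[of m] assms(1)
    by (intro cInf_lower) (auto intro!: bdd_belowI[where m=0])
  moreover have "(\<lambda>m. d + 1 / real (Suc m)) \<longlonglongrightarrow> d + 0"
    by (intro tendsto_intros LIMSEQ_inverse_real_of_nat[unfolded inverse_eq_divide])
  ultimately show "macro_DimH E \<le> d"
    by (intro LIMSEQ_le_const[where X="\<lambda>m. d + 1 / real (Suc m)"]) auto
  show "d \<le> macro_DimH E"
    unfolding macro_DimH_def
  proof (rule cInf_greatest)
    have "d + 1 / real (Suc 0) \<in> {\<rho>. 0 \<le> \<rho> \<and> summable (\<lambda>n. macro_nu (Suc n) \<rho> E)}"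
      using up[of 0] assms(1) by simp
    then show "{\<rho>. 0 \<le> \<rho> \<and> summable (\<lambda>n. macro_nu (Suc n) \<rho> E)} \<noteq> {}" by blast
  qed (use low in force)
qed

text \<open>The point \<open>a + s\<close> is approached through its dyadic truncations
  \<open>d m\<close>. Consecutive truncations agree or are adjacent on the finer grid, so the
  increments add up to at most a geometric series, and continuity carries the bound to the
  limit.\<close>

lemma dyadic_chaining:
  fixes f :: "real \<Rightarrow> real"
  assumes cont: "continuous_on {a..a + 1} f"
    and r: "0 \<le> r" "r < 1"
    and incr: "\<And>m i. i < 2 ^ m \<Longrightarrow>
      \<bar>f (a + real (Suc i) / 2 ^ m) - f (a + real i / 2 ^ m)\<bar> \<le> c * r ^ m"
    and s: "0 \<le> s" "s < 1"
  shows "\<bar>f (a + s) - f a\<bar> \<le> c / (1 - r)"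
proof -
  define g where "g m = nat \<lfloor>s * 2 ^ m\<rfloor>" for m
  define d where "d m = a + real (g m) / 2 ^ m" for m
  have g: "real (g m) \<le> s * 2 ^ m" "s * 2 ^ m < real (g m) + 1" for m
  proof -
    have "0 \<le> s * 2 ^ m" using s by simp
    then show "real (g m) \<le> s * 2 ^ m" "s * 2 ^ m < real (g m) + 1" unfolding g_def by linarith+
  qed
  have c: "0 \<le> c" using incr[of 0 0] by simp
  have bound: "\<bar>f (d m) - f a\<bar> \<le> c * (\<Sum>i\<le>m. r ^ i)" for m
  proof (induction m)
    case 0
    have "g 0 = 0" using g(1)[of 0] s(2) by simp
    then show ?case using c by (simp add: d_def)
  next
    case (Suc m)
    \<comment> \<open>Refining the grid appends one binary digit: \<open>g (Suc m)\<close> is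
      \<open>2 * g m\<close> or \<open>2 * g m + 1\<close>.\<close>
    have "real (2 * g m) < real (g (Suc m) + 1)" using g[of m] g[of "Suc m"] by simp
    then have 1: "2 * g m \<le> g (Suc m)" unfolding of_nat_less_iff by linarith
    have "real (g (Suc m)) < real (2 * g m + 2)" using g[of m] g[of "Suc m"] by simp
    then have 2: "g (Suc m) \<le> 2 * g m + 1" unfolding of_nat_less_iff by linarith
    have "\<bar>f (d (Suc m)) - f (d m)\<bar> \<le> c * r ^ Suc m"
    proof (cases "g (Suc m) = 2 * g m")
      case True
      then have "d (Suc m) = d m" by (simp add: d_def)
      then show ?thesis using c r by simp
    next
      case False
      with 1 2 have eq: "g (Suc m) = Suc (2 * g m)" by linarith
      have "real (g (Suc m)) < 2 ^ Suc m"
        by (rule order.strict_trans1[OF g(1)]) (use mult_strict_right_mono[OF s(2), of "2 ^ Suc m"] in simp)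
      then have "Suc (2 * g m) < 2 ^ Suc m" unfolding eq by (simp only: of_nat_less_numeral_power_cancel_iff)
      then have lt: "2 * g m < 2 ^ Suc m" by (rule Suc_lessD)
      have "d m = a + real (2 * g m) / 2 ^ Suc m" by (simp add: d_def)
      then show ?thesis using incr[OF lt] by (simp only: d_def eq)
    qed
    then show ?case using Suc by (simp add: algebra_simps)
  qed
  have lim: "d \<longlonglongrightarrow> a + s"
  proof (rule tendsto_sandwich[where f="\<lambda>m. a + s - (1/2) ^ m" and h="\<lambda>m. a + s"])
    have "(\<lambda>m. a + s - (1/2) ^ m) \<longlonglongrightarrow> a + s - 0"
      by (intro tendsto_intros LIMSEQ_power_zero) simp
    then show "(\<lambda>m. a + s - (1/2) ^ m) \<longlonglongrightarrow> a + s" by simp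
    show "\<forall>\<^sub>F m in sequentially. a + s - (1/2) ^ m \<le> d m"
    proof (intro always_eventually allI)
      fix m
      have "s \<le> (real (g m) + 1) / 2 ^ m" using g(2)[of m] by (simp add: pos_le_divide_eq less_imp_le)
      then show "a + s - (1/2) ^ m \<le> d m"
        by (simp add: d_def add_divide_distrib power_one_over)
    qed
    show "\<forall>\<^sub>F m in sequentially. d m \<le> a + s"
      using g(1) by (auto intro!: always_eventually simp: d_def pos_divide_le_eq)
  qed simp
  have dm: "d m \<in> {a..a + 1}" for m
  proof -
    have "real (g m) / 2 ^ m \<le> s" using g(1)[of m] by (simp add: pos_divide_le_eq)
    moreover have "0 \<le> real (g m) / 2 ^ m" by simp
    ultimately show ?thesis using s unfolding d_def atLeastAtMost_iff by linarith
  qed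
  have "(\<lambda>m. f (d m)) \<longlonglongrightarrow> f (a + s)"
    by (rule continuous_on_tendsto_compose[OF cont lim]) (use s dm in auto)
  then have "(\<lambda>m. \<bar>f (d m) - f a\<bar>) \<longlonglongrightarrow> \<bar>f (a + s) - f a\<bar>"
    by (intro tendsto_intros)
  moreover have "\<bar>f (d m) - f a\<bar> \<le> c / (1 - r)" for m
  proof -
    have "(\<Sum>i\<le>m. r ^ i) \<le> (\<Sum>i. r ^ i)"
      using r by (intro sum_le_suminf summable_geometric) auto
    also have "\<dots> = 1 / (1 - r)" using r by (intro suminf_geometric) auto
    finally have "c * (\<Sum>i\<le>m. r ^ i) \<le> c * (1 / (1 - r))" using c by (rule mult_left_mono)
    then show ?thesis using bound[of m] by simp
  qed
  ultimately show ?thesis by (intro LIMSEQ_le_const2) auto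
qed

text \<open>Used to replace \<open>1 / sqrt (l * (l - k - 1))\<close>, which bounds pair
  probabilities, by the product form \<open>1 / l\<close>; uniformity in \<open>K\<close> keeps the
  variance linear. The sum telescopes against \<open>2 * \<phi>\<close>: with
  \<open>l = m + K\<close> and \<open>a = m / l\<close>, each term is at most
  \<open>(1 - a) / (l * sqrt a)\<close>, which is the derivative of \<open>2 * \<phi>\<close> at
  \<open>m\<close>.\<close>

lemma sum_inverse_sqrt_diff_le:
  "(\<Sum>m=1..M. 1 / sqrt (real (m + K) * real m) - 1 / real (m + K)) \<le> 2"
proof -
  define \<phi> where "\<phi> m = sqrt (real m / real (m + K))" for m
  have "(\<Sum>m=1..M. 1 / sqrt (real (m + K) * real m) - 1 / real (m + K)) \<le> 2 * (\<phi> M - \<phi> 0)"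
  proof (induction M)
    case (Suc M)
    define l where "l = real (Suc M + K)"
    define a where "a = real (Suc M) / l"
    define b where "b = real M / real (M + K)"
    have l: "0 < l" by (simp add: l_def)
    have a: "0 < a" "a \<le> 1" using l by (auto simp: a_def l_def)
    have sa: "0 < sqrt a" "sqrt a \<le> 1" using a by auto
    have ba: "b \<le> a"
      unfolding a_def b_def l_def by (cases "M + K = 0") (auto simp: divide_simps algebra_simps)
    have b0: "0 \<le> b" by (simp add: b_def)
    have diff: "(1 - a) / l \<le> a - b"
    \<comment> \<open>For \<open>M = 0\<close> the value \<open>b\<close> is 0, also when
      \<open>K = 0\<close> and the quotient reads 0 / 0.\<close>
    proof (cases "M = 0")
      case True
      then show ?thesis using l by (simp add: a_def b_def l_def divide_simps)
    next
      case False
      then show ?thesis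
        unfolding a_def b_def l_def by (simp add: divide_simps) (simp add: algebra_simps)
    qed
    have "real (Suc M + K) * real (Suc M) = l\<^sup>2 * a"
      using l by (simp add: a_def power2_eq_square l_def)
    then have root: "sqrt (real (Suc M + K) * real (Suc M)) = l * sqrt a"
      using l by (simp only: real_sqrt_mult real_sqrt_abs abs_of_pos)
    have "1 / sqrt (real (Suc M + K) * real (Suc M)) - 1 / real (Suc M + K) = 1 / (l * sqrt a) - 1 / l"
      unfolding root by (simp add: l_def)
    also have "\<dots> = (1 - sqrt a) / (l * sqrt a)"
      using l sa by (simp add: divide_simps)
    also have "(1 - sqrt a) / (l * sqrt a) \<le> (1 - a) / (l * sqrt a)"
    proof (intro divide_right_mono)
      have "sqrt a * sqrt a \<le> sqrt a * 1" using sa by (intro mult_left_mono) auto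
      then show "1 - sqrt a \<le> 1 - a" using a by simp
    qed (use l sa in auto)
    also have "\<dots> \<le> (a - b) / sqrt a"
      using divide_right_mono[OF diff, of "sqrt a"] sa by simp
    also have "\<dots> \<le> 2 * (sqrt a - sqrt b)"
    proof -
      have "a - b = (sqrt a - sqrt b) * (sqrt a + sqrt b)"
        using a b0 by (simp add: algebra_simps)
      also have "\<dots> \<le> (sqrt a - sqrt b) * (2 * sqrt a)"
        using ba by (intro mult_left_mono) auto
      finally have "a - b \<le> 2 * (sqrt a - sqrt b) * sqrt a" by (simp only: ac_simps)
      then show ?thesis using sa(1) by (simp only: pos_divide_le_eq)
    qed
    also have "\<dots> = 2 * (\<phi> (Suc M) - \<phi> M)" by (simp add: \<phi>_def a_def b_def l_def)
    finally show ?case using Suc.IH by (simp only: sum.nat_ivl_Suc' algebra_simps)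
  qed simp
  also have "\<dots> \<le> 2"
  proof -
    have "\<phi> M \<le> 1" unfolding \<phi>_def by (simp add: divide_le_eq)
    moreover have "0 \<le> \<phi> 0" unfolding \<phi>_def by simp
    ultimately show ?thesis by simp
  qed
  finally show ?thesis .
qed

text \<open>Discrete form of an integral comparison: by concavity of \<open>x powr t\<close>, every
  term is at most the increment of \<open>x powr t / t\<close>.\<close>

lemma sum_powr_le:
  assumes "0 < t" "t < 1"
  shows "(\<Sum>m=1..M. real m powr (t - 1)) \<le> real M powr t / t"
proof (induction M)
  case (Suc M)
  have "t * real (Suc M) powr (t - 1) \<le> real (Suc M) powr t - real M powr t"
  proof -
    have "real M powr t \<le> real (Suc M) powr t * (1 - t / real (Suc M))"
    proof (cases "M = 0")
      case False
      define x where "x = real M / real (Suc M)"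
      have x: "0 < x" "real M = real (Suc M) * x" using False by (auto simp: x_def)
      \<comment> \<open>The tangent bound for \<open>x powr t\<close> at 1, obtained as a weighted
        inequality of arithmetic and geometric means.\<close>
      have "x powr t * 1 powr (1 - t) \<le> t * x + (1 - t) * 1"
        using assms x by (intro Youngs_inequality_0) auto
      also have "\<dots> = 1 - t / real (Suc M)" by (simp add: x_def field_simps)
      finally have "real (Suc M) powr t * x powr t \<le> real (Suc M) powr t * (1 - t / real (Suc M))"
        by (intro mult_left_mono) auto
      moreover have "real M powr t = real (Suc M) powr t * x powr t"
        by (subst x(2)) (use x(1) in \<open>simp add: powr_mult\<close>)
      ultimately show ?thesis by simp
    qed (use assms in auto)
    moreover have "real (Suc M) powr (t - 1) = real (Suc M) powr t / real (Suc M)"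
      by (simp add: powr_diff)
    ultimately show ?thesis by (simp add: algebra_simps)
  qed
  then show ?case using Suc assms by (simp add: field_simps)
qed simp

subsection \<open>Brownian increments\<close>

text \<open>By Tonelli the sum has finite expectation, hence it is finite almost surely.\<close>

lemma AE_summable_of_summable_integral:
  fixes f :: "nat \<Rightarrow> 'a \<Rightarrow> real"
  assumes int: "\<And>n. integrable M (f n)" and nonneg: "\<And>n \<omega>. 0 \<le> f n \<omega>"
    and sum: "summable (\<lambda>n. integral\<^sup>L M (f n))"
  shows "AE \<omega> in M. summable (\<lambda>n. f n \<omega>)"
proof -
  note [measurable] = borel_measurable_integrable[OF int]
  have "(\<integral>\<^sup>+\<omega>. (\<Sum>n. ennreal (f n \<omega>)) \<partial>M) = (\<Sum>n. \<integral>\<^sup>+\<omega>. ennreal (f n \<omega>) \<partial>M)"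
    by (rule nn_integral_suminf) measurable
  also have "\<dots> = (\<Sum>n. ennreal (integral\<^sup>L M (f n)))"
    using int nonneg by (simp add: nn_integral_eq_integral)
  also have "\<dots> = ennreal (\<Sum>n. integral\<^sup>L M (f n))"
    using sum nonneg by (intro suminf_ennreal2) auto
  finally have "(\<integral>\<^sup>+\<omega>. (\<Sum>n. ennreal (f n \<omega>)) \<partial>M) \<noteq> \<infinity>" by simp
  then have "AE \<omega> in M. (\<Sum>n. ennreal (f n \<omega>)) \<noteq> \<infinity>"
    by (intro nn_integral_PInf_AE) measurable
  then show ?thesis
    by eventually_elim (intro summable_suminf_not_top nonneg, simp)
qed

text \<open>Given \<open>Z\<close>, the event forces \<open>h W\<close> into an interval of length
  \<open>v - u\<close>, and the density of \<open>h W\<close> is at most \<open>b\<close>;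
  integrating over \<open>Z\<close> gives the product. The map \<open>h\<close> is present because
  \<open>W\<close> will be an increment in the guise of a function on a singleton index set.\<close>

lemma (in prob_space) prob_add_indep_le:
  fixes f :: "real \<Rightarrow> real"
  assumes ind: "indep_var N Z L W" and h: "h \<in> borel_measurable L"
    and D: "distributed M lborel (\<lambda>\<omega>. h (W \<omega>)) (\<lambda>x. ennreal (f x))" and f: "\<And>x. f x \<le> b"
    and g: "g \<in> borel_measurable N" and A: "A \<in> sets N" and uv: "u \<le> v"
  shows "\<P>(\<omega> in M. Z \<omega> \<in> A \<and> g (Z \<omega>) + h (W \<omega>) \<in> {u..v}) \<le> b * (v - u) * \<P>(\<omega> in M. Z \<omega> \<in> A)"
proof (cases "b \<ge> 0")
  let ?Y = "\<lambda>\<omega>. h (W \<omega>)"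
  case False
  \<comment> \<open>A negative \<open>b\<close> would make the density vanish, against total mass
    one.\<close>
  then have "(\<lambda>x. ennreal (f x)) = (\<lambda>x. 0)"
    using f False by (auto simp: fun_eq_iff ennreal_eq_0_iff intro: order_trans[of _ b])
  then have "distr M lborel ?Y = density lborel (\<lambda>x. 0)" using D by (simp add: distributed_def)
  then have "emeasure (distr M lborel ?Y) UNIV = 0" by (simp add: emeasure_density)
  moreover have "?Y \<in> measurable M lborel" using D by (simp add: distributed_def)
  ultimately show ?thesis using emeasure_space_1 by (simp add: emeasure_distr)
next
  case b: True
  let ?Y = "\<lambda>\<omega>. h (W \<omega>)"
  note [measurable] = g A h
  have rv: "random_variable N Z" "random_variable L W"
    and eq: "distr M N Z \<Otimes>\<^sub>M distr M L W = distr M (N \<Otimes>\<^sub>M L) (\<lambda>x. (Z x, W x))"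
    using ind by (auto simp: indep_var_distribution_eq)
  note [measurable] = rv
  interpret Z: prob_space "distr M N Z" by (rule prob_space_distr) fact
  interpret W: prob_space "distr M L W" by (rule prob_space_distr) fact
  interpret ZW: pair_prob_space "distr M N Z" "distr M L W" ..
  let ?H = "\<lambda>p. indicator A (fst p) * indicator {u..v} (g (fst p) + h (snd p)) :: ennreal"
  have H[measurable]: "?H \<in> borel_measurable (N \<Otimes>\<^sub>M L)" by measurable
  have fm: "(\<lambda>x. ennreal (f x)) \<in> borel_measurable borel"
    using D by (simp add: distributed_def)
  have dY: "distr M borel ?Y = density lborel (\<lambda>x. ennreal (f x))"
  proof -
    have "distr M borel ?Y = distr M lborel ?Y" by (rule distr_cong) auto
    then show ?thesis using D by (simp add: distributed_def)
  qed
  have inner: "emeasure (distr M borel ?Y) {u'..v'} \<le> ennreal (b * (v' - u'))" if "u' \<le> v'" for u' v'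
  proof -
    have "emeasure (distr M borel ?Y) {u'..v'} = (\<integral>\<^sup>+x. ennreal (f x) * indicator {u'..v'} x \<partial>lborel)"
      unfolding dY using fm by (intro emeasure_density) auto
    also have "\<dots> \<le> (\<integral>\<^sup>+x. ennreal b * indicator {u'..v'} x \<partial>lborel)"
      using f b by (intro nn_integral_mono mult_right_mono ennreal_leI) auto
    also have "\<dots> = ennreal (b * (v' - u'))"
      using that b by (simp add: nn_integral_cmult_indicator ennreal_mult)
    finally show ?thesis .
  qed
  have "ennreal (\<P>(\<omega> in M. Z \<omega> \<in> A \<and> g (Z \<omega>) + h (W \<omega>) \<in> {u..v})) =
      (\<integral>\<^sup>+\<omega>. indicator {\<omega>\<in>space M. Z \<omega> \<in> A \<and> g (Z \<omega>) + h (W \<omega>) \<in> {u..v}} \<omega> \<partial>M)"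
    by (simp add: emeasure_eq_measure)
  also have "\<dots> = (\<integral>\<^sup>+\<omega>. ?H (Z \<omega>, W \<omega>) \<partial>M)"
    by (intro nn_integral_cong) (auto simp: indicator_def)
  also have "\<dots> = (\<integral>\<^sup>+p. ?H p \<partial>distr M (N \<Otimes>\<^sub>M L) (\<lambda>x. (Z x, W x)))"
    by (subst nn_integral_distr) auto
  \<comment> \<open>Independence enters here: the joint law is the product of the two laws.\<close>
  also have "\<dots> = (\<integral>\<^sup>+p. ?H p \<partial>(distr M N Z \<Otimes>\<^sub>M distr M L W))"
    by (simp add: eq)
  also have "\<dots> = (\<integral>\<^sup>+z. \<integral>\<^sup>+y. ?H (z, y) \<partial>distr M L W \<partial>distr M N Z)"
    by (subst W.nn_integral_fst[symmetric]) simp_all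
  also have "\<dots> \<le> (\<integral>\<^sup>+z. ennreal (b * (v - u)) * indicator A z \<partial>distr M N Z)"
  proof (intro nn_integral_mono)
    fix z assume z: "z \<in> space (distr M N Z)"
    have "(\<integral>\<^sup>+y. ?H (z, y) \<partial>distr M L W) =
        (\<integral>\<^sup>+y. indicator A z * indicator {u - g z..v - g z} (h y) \<partial>distr M L W)"
      by (intro nn_integral_cong) (auto simp: indicator_def)
    also have "\<dots> = indicator A z * (\<integral>\<^sup>+y. indicator {u - g z..v - g z} (h y) \<partial>distr M L W)"
      by (simp add: nn_integral_cmult)
    also have "(\<integral>\<^sup>+y. indicator {u - g z..v - g z} (h y) \<partial>distr M L W) =
        (\<integral>\<^sup>+y. indicator {u - g z..v - g z} y \<partial>distr M borel ?Y)"
      by (simp add: nn_integral_distr del: nn_integral_indicator)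
    also have "\<dots> = emeasure (distr M borel ?Y) {u - g z..v - g z}"
      by simp
    also have "indicator A z * emeasure (distr M borel ?Y) {u - g z..v - g z} \<le> indicator A z * ennreal (b * ((v - g z) - (u - g z)))"
      using uv by (intro mult_left_mono inner) auto
    finally show "(\<integral>\<^sup>+y. ?H (z, y) \<partial>distr M L W) \<le> ennreal (b * (v - u)) * indicator A z"
      by (simp add: mult.commute)
  qed
  also have "\<dots> = ennreal (b * (v - u)) * emeasure M {\<omega>\<in>space M. Z \<omega> \<in> A}"
    by (simp add: nn_integral_cmult_indicator emeasure_distr vimage_def Int_def conj_commute)
  also have "\<dots> = ennreal (b * (v - u) * \<P>(\<omega> in M. Z \<omega> \<in> A))"
    using b uv by (simp add: emeasure_eq_measure ennreal_mult)
  finally show ?thesis using b uv by (simp add: ennreal_le_iff)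
qed

section \<open>Gaussian increments of Brownian motion\<close>

lemma normal_density_0: "\<sigma> > 0 \<Longrightarrow> normal_density 0 \<sigma> x = exp (- x\<^sup>2 / (2 * \<sigma>\<^sup>2)) / (sqrt (2 * pi) * \<sigma>)"
  by (simp add: normal_density_def real_sqrt_mult)

lemma normal_density_le: "\<sigma> > 0 \<Longrightarrow> normal_density 0 \<sigma> x \<le> 1 / (sqrt (2 * pi) * \<sigma>)"
  by (simp add: normal_density_0 divide_right_mono)

locale brownian_motion =
  fixes M :: "'a measure" and B :: "real \<Rightarrow> 'a \<Rightarrow> real"
  assumes BM: "standard_BM M B"

sublocale brownian_motion \<subseteq> prob_space M
  using BM by (simp add: standard_BM_def)

context brownian_motion
begin

lemma measurable_B [measurable]: "B t \<in> borel_measurable M"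
  using BM by (simp add: standard_BM_def)

lemma distributed_increment:
  "0 \<le> s \<Longrightarrow> s < t \<Longrightarrow> distributed M lborel (\<lambda>\<omega>. B t \<omega> - B s \<omega>) (normal_density 0 (sqrt (t - s)))"
  using BM by (simp add: standard_BM_def)

text \<open>The past is packed into one vector, so that an event about displacements up to time
  \<open>ts m\<close> becomes a measurable set of vectors; the last increment is a vector with a
  single entry.\<close>

lemma indep_increment:
  assumes "0 \<le> ts 0" "\<And>i. i \<le> m \<Longrightarrow> ts i < ts (Suc i)"
  shows "indep_var (PiM {..<m} (\<lambda>_. borel)) (\<lambda>\<omega>. \<lambda>i\<in>{..<m}. B (ts (Suc i)) \<omega> - B (ts i) \<omega>)
           (PiM {m} (\<lambda>_. borel)) (\<lambda>\<omega>. \<lambda>i\<in>{m}. B (ts (Suc i)) \<omega> - B (ts i) \<omega>)"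
proof -
  have "indep_vars (\<lambda>_. borel) (\<lambda>i \<omega>. B (ts (Suc i)) \<omega> - B (ts i) \<omega>) {..<Suc m}"
    using BM assms unfolding standard_BM_def by (simp add: less_Suc_eq_le)
  then show ?thesis by (rule indep_var_restrict) auto
qed

lemma prob_increment_eq:
  assumes "0 \<le> s" "s < t" "A \<in> sets borel"
  shows "\<P>(\<omega> in M. B t \<omega> - B s \<omega> \<in> A) = measure (density lborel (normal_density 0 (sqrt (t - s)))) A"
proof -
  note D = distributed_increment[OF assms(1,2)]
  have "measure (distr M lborel (\<lambda>\<omega>. B t \<omega> - B s \<omega>)) A = \<P>(\<omega> in M. B t \<omega> - B s \<omega> \<in> A)"
    using assms(3) by (subst measure_distr) (auto intro!: arg_cong[where f=prob])
  then show ?thesis using D by (simp add: distributed_def)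
qed

lemma prob_increment_le:
  assumes "0 \<le> s" "s < t" "u \<le> v"
  shows "\<P>(\<omega> in M. B t \<omega> - B s \<omega> \<in> {u..v}) \<le> (v - u) / (sqrt (2 * pi) * sqrt (t - s))"
proof -
  have "emeasure (density lborel (normal_density 0 (sqrt (t - s)))) {u..v} =
      (\<integral>\<^sup>+x. ennreal (normal_density 0 (sqrt (t - s)) x) * indicator {u..v} x \<partial>lborel)"
    by (intro emeasure_density) auto
  also have "\<dots> \<le> (\<integral>\<^sup>+x. ennreal (1 / (sqrt (2 * pi) * sqrt (t - s))) * indicator {u..v} x \<partial>lborel)"
    using assms by (intro nn_integral_mono mult_right_mono ennreal_leI normal_density_le) auto
  also have "\<dots> = ennreal (1 / (sqrt (2 * pi) * sqrt (t - s)) * (v - u))"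
    using assms by (subst nn_integral_cmult_indicator) (auto simp: ennreal_mult[symmetric])
  finally have "measure (density lborel (normal_density 0 (sqrt (t - s)))) {u..v} \<le>
      1 / (sqrt (2 * pi) * sqrt (t - s)) * (v - u)"
    unfolding measure_def using assms by (intro enn2real_leI) auto
  then show ?thesis using assms by (subst prob_increment_eq) auto
qed

text \<open>On \<open>{u..v}\<close> the density is at least its value at \<open>c\<close>, and
  \<open>exp (- y) \<ge> 1 - y\<close>. For time \<open>k\<close> and a fixed level the relative
  loss is of order \<open>1 / k\<close>, which is summable against \<open>1 / k\<close>.\<close>

lemma prob_increment_ge:
  assumes "0 \<le> s" "s < t" "u \<le> v" and c: "\<And>x. x \<in> {u..v} \<Longrightarrow> \<bar>x\<bar> \<le> c"
  shows "(v - u) / (sqrt (2 * pi) * sqrt (t - s)) * (1 - c\<^sup>2 / (2 * (t - s)))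
    \<le> \<P>(\<omega> in M. B t \<omega> - B s \<omega> \<in> {u..v})"
proof -
  define b where "b = exp (- c\<^sup>2 / (2 * (t - s))) / (sqrt (2 * pi) * sqrt (t - s))"
  have b0: "0 \<le> b" using assms by (simp add: b_def)
  have "b \<le> normal_density 0 (sqrt (t - s)) x" if "x \<in> {u..v}" for x
  proof -
    have "x\<^sup>2 \<le> c\<^sup>2" using c[OF that] by (simp add: abs_le_square_iff[symmetric])
    then have "- c\<^sup>2 / (2 * (t - s)) \<le> - x\<^sup>2 / (2 * (t - s))"
      using assms by (intro divide_right_mono) auto
    then show ?thesis
      using assms by (simp add: normal_density_0 b_def divide_right_mono)
  qed
  then have "(\<integral>\<^sup>+x. ennreal b * indicator {u..v} x \<partial>lborel) \<le>
      (\<integral>\<^sup>+x. ennreal (normal_density 0 (sqrt (t - s)) x) * indicator {u..v} x \<partial>lborel)"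
    by (intro nn_integral_mono) (auto simp: indicator_def intro!: ennreal_leI)
  also have "\<dots> = emeasure (density lborel (normal_density 0 (sqrt (t - s)))) {u..v}"
    by (intro emeasure_density[symmetric]) auto
  also have "(\<integral>\<^sup>+x. ennreal b * indicator {u..v} x \<partial>lborel) = ennreal (b * (v - u))"
    using assms b0 by (subst nn_integral_cmult_indicator) (auto simp: ennreal_mult[symmetric])
  finally have le: "b * (v - u) \<le> measure (density lborel (normal_density 0 (sqrt (t - s)))) {u..v}"
    using assms b0 prob_space_normal_density[of "sqrt (t - s)" 0]
    by (subst (asm) finite_measure.emeasure_eq_measure) (auto dest: prob_space.finite_measure)
  have "1 - c\<^sup>2 / (2 * (t - s)) \<le> exp (- c\<^sup>2 / (2 * (t - s)))"
    using exp_ge_add_one_self[of "- c\<^sup>2 / (2 * (t - s))"] by simp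
  then have "(v - u) / (sqrt (2 * pi) * sqrt (t - s)) * (1 - c\<^sup>2 / (2 * (t - s))) \<le>
      (v - u) / (sqrt (2 * pi) * sqrt (t - s)) * exp (- c\<^sup>2 / (2 * (t - s)))"
    using assms by (intro mult_left_mono) auto
  also have "\<dots> = b * (v - u)" by (simp add: b_def)
  finally show ?thesis using le assms by (subst prob_increment_eq) auto
qed

text \<open>Markov's inequality for an even moment; the quotient of factorials is the double
  factorial in the Gaussian moment of order \<open>2 * p\<close>. The parameter \<open>p\<close>
  stays free because decay of arbitrarily high polynomial order is required later.\<close>

lemma prob_increment_tail:
  assumes "0 \<le> s" "s < t" "0 < a"
  shows "\<P>(\<omega> in M. a < \<bar>B t \<omega> - B s \<omega>\<bar>) \<le> fact (2 * p) / (2 ^ p * fact p) * (t - s) ^ p / a ^ (2 * p)"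
proof -
  note D = distributed_increment[OF assms(1,2)]
  let ?D = "\<lambda>\<omega>. B t \<omega> - B s \<omega>"
  have \<sigma>: "0 < sqrt (t - s)" using assms by simp
  have int: "integrable M (\<lambda>\<omega>. ?D \<omega> ^ (2 * p))"
    by (subst distributed_integrable[OF D, symmetric])
      (use integrable_normal_moment[OF \<sigma>, of 0 "2 * p"] in auto)
  have "(\<integral>\<omega>. ?D \<omega> ^ (2 * p) \<partial>M) = (\<integral>x. normal_density 0 (sqrt (t - s)) x * x ^ (2 * p) \<partial>lborel)"
    by (subst distributed_integral[OF D, symmetric]) auto
  also have "\<dots> = fact (2 * p) / ((2 / (sqrt (t - s))\<^sup>2) ^ p * fact p)"
    using integral_normal_moment_even[OF \<sigma>, of 0 p] by simp
  also have "\<dots> = fact (2 * p) / (2 ^ p * fact p) * (t - s) ^ p"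
    using assms by (simp add: power_divide)
  finally have E: "(\<integral>\<omega>. ?D \<omega> ^ (2 * p) \<partial>M) = fact (2 * p) / (2 ^ p * fact p) * (t - s) ^ p" .
  have "\<P>(\<omega> in M. a < \<bar>?D \<omega>\<bar>) \<le> \<P>(\<omega> in M. a ^ (2 * p) \<le> ?D \<omega> ^ (2 * p))"
  proof (intro finite_measure_mono)
    show "{\<omega> \<in> space M. a < \<bar>?D \<omega>\<bar>} \<subseteq> {\<omega> \<in> space M. a ^ (2 * p) \<le> ?D \<omega> ^ (2 * p)}"
    proof safe
      fix \<omega> assume "a < \<bar>?D \<omega>\<bar>"
      then have "a ^ (2 * p) \<le> \<bar>?D \<omega>\<bar> ^ (2 * p)" using assms by (intro power_mono) auto
      then show "a ^ (2 * p) \<le> ?D \<omega> ^ (2 * p)" by (simp add: power_even_abs)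
    qed
  qed measurable
  also have "\<dots> \<le> (\<integral>\<omega>. ?D \<omega> ^ (2 * p) \<partial>M) / a ^ (2 * p)"
    by (rule integral_Markov_inequality_measure[OF int, where A="{}"]) (use assms in auto)
  finally show ?thesis by (simp add: E)
qed

lemma prob_indep_increment:
  assumes ts: "0 \<le> ts 0" "\<And>i. i \<le> m \<Longrightarrow> ts i < ts (Suc i)"
    and A: "A \<in> sets (PiM {..<m} (\<lambda>_. borel))" and C: "C \<in> sets borel"
  shows "\<P>(\<omega> in M. (\<lambda>i\<in>{..<m}. B (ts (Suc i)) \<omega> - B (ts i) \<omega>) \<in> A \<and> B (ts (Suc m)) \<omega> - B (ts m) \<omega> \<in> C)
    = \<P>(\<omega> in M. (\<lambda>i\<in>{..<m}. B (ts (Suc i)) \<omega> - B (ts i) \<omega>) \<in> A) * \<P>(\<omega> in M. B (ts (Suc m)) \<omega> - B (ts m) \<omega> \<in> C)"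
proof -
  let ?C = "{f \<in> space (PiM {m} (\<lambda>_. borel)). f m \<in> C}"
  have C': "?C \<in> sets (PiM {m} (\<lambda>_. borel))" using C by measurable
  show ?thesis
    using indep_varD[OF indep_increment[OF ts] A C']
    by (simp add: vimage_def Int_def conj_commute space_PiM)
qed

text \<open>With \<open>g\<close> the displacement reached at time \<open>ts m\<close>, this bounds
  the chance of landing in a given interval at the next time, whatever event \<open>A\<close> is
  imposed on the past.\<close>

lemma prob_indep_increment_le:
  assumes ts: "0 \<le> ts 0" "\<And>i. i \<le> m \<Longrightarrow> ts i < ts (Suc i)"
    and A: "A \<in> sets (PiM {..<m} (\<lambda>_. borel))" and g: "g \<in> borel_measurable (PiM {..<m} (\<lambda>_. borel))"
    and uv: "u \<le> v"
  shows "\<P>(\<omega> in M. (\<lambda>i\<in>{..<m}. B (ts (Suc i)) \<omega> - B (ts i) \<omega>) \<in> A \<and>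
      g (\<lambda>i\<in>{..<m}. B (ts (Suc i)) \<omega> - B (ts i) \<omega>) + (B (ts (Suc m)) \<omega> - B (ts m) \<omega>) \<in> {u..v})
    \<le> (v - u) / (sqrt (2 * pi) * sqrt (ts (Suc m) - ts m)) *
      \<P>(\<omega> in M. (\<lambda>i\<in>{..<m}. B (ts (Suc i)) \<omega> - B (ts i) \<omega>) \<in> A)"
proof -
  have "0 \<le> ts i" if "i \<le> m" for i
    using that
  proof (induction i)
    case (Suc i)
    then show ?case using ts(2)[of i] by simp
  qed (use ts in simp)
  then have D: "distributed M lborel (\<lambda>\<omega>. B (ts (Suc m)) \<omega> - B (ts m) \<omega>) (normal_density 0 (sqrt (ts (Suc m) - ts m)))"
    using ts by (intro distributed_increment) auto
  have "(\<lambda>f. f m) \<in> borel_measurable (PiM {m} (\<lambda>_. borel))" by measurable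
  from prob_add_indep_le[OF indep_increment[OF ts] this _ _ g A uv, where f="normal_density 0 (sqrt (ts (Suc m) - ts m))"
      and b="1 / (sqrt (2 * pi) * sqrt (ts (Suc m) - ts m))"]
  show ?thesis using D ts(2)[of m] normal_density_le[of "sqrt (ts (Suc m) - ts m)"] by simp
qed

text \<open>On this event the path started at 0 crosses the whole of \<open>[j, j + 1)\<close> during \<open>[k, k + 1)\<close>.
  Asking for a jump of size 2 instead of a crossing makes the two conditions independent.\<close>

definition touch :: "real \<Rightarrow> nat \<Rightarrow> 'a set" where
  "touch j k = {\<omega> \<in> space M. B k \<omega> - B 0 \<omega> \<in> {j - 1..j} \<and> 2 \<le> B (real k + 1) \<omega> - B k \<omega>}"

lemma sets_touch [measurable]: "touch j k \<in> sets M"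
  unfolding touch_def by measurable

section \<open>Probabilities of marked points\<close>

definition jump_prob :: real where
  "jump_prob = measure (density lborel (normal_density 0 1)) {2..}"

lemma jump_prob_pos: "0 < jump_prob" and jump_prob_le_1: "jump_prob \<le> 1"
proof -
  interpret N: prob_space "density lborel (normal_density 0 1)"
    by (rule prob_space_normal_density) simp
  show "jump_prob \<le> 1" unfolding jump_prob_def by (rule N.prob_le_1)
  \<comment> \<open>The density is positive everywhere, so a null \<open>{2..}\<close> would make
    \<open>{2..3}\<close> a Lebesgue null set.\<close>
  have "jump_prob \<noteq> 0"
  proof
    assume "jump_prob = 0"
    then have "emeasure (density lborel (normal_density 0 1)) {2..} = 0"
      by (simp add: jump_prob_def N.emeasure_eq_measure)
    then have "{2..} \<in> null_sets (density lborel (normal_density 0 (1::real)))" by (simp add: null_sets_def)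
    then have "AE x in lborel. x \<in> {2..} \<longrightarrow> ennreal (normal_density 0 1 x) = 0"
      by (subst (asm) null_sets_density_iff) auto
    then have "AE x in lborel. x \<notin> {2..3::real}"
    proof (rule AE_mp, intro AE_I2 impI)
      fix x :: real assume "x \<in> {2..} \<longrightarrow> ennreal (normal_density 0 1 x) = 0"
      then show "x \<notin> {2..3}" using normal_density_pos[of 1 0 x] by (auto simp: ennreal_eq_0_iff)
    qed
    then have "emeasure lborel {2..3::real} = 0" by (subst (asm) AE_iff_measurable[of "{2..3}"]) auto
    then show False by simp
  qed
  then show "0 < jump_prob" using measure_nonneg[of _ "{2..}"] unfolding jump_prob_def by (simp add: less_le)
qed

text \<open>\<open>rate / sqrt k\<close> is the leading order of \<open>prob (touch j k)\<close>:
  the jump probability times the value at 0 of the centred Gaussian density of variance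
  \<open>k\<close>, for an interval of length one.\<close>

definition rate :: real where
  "rate = jump_prob / sqrt (2 * pi)"

lemma rate_pos: "0 < rate" and rate_le_1: "rate \<le> 1"
proof -
  show "0 < rate" unfolding rate_def using jump_prob_pos by simp
  have "1 \<le> sqrt (2 * pi)" using pi_gt3 by simp
  then have "jump_prob \<le> sqrt (2 * pi)" by (rule order_trans[OF jump_prob_le_1])
  then show "rate \<le> 1" unfolding rate_def by (simp add: divide_le_eq)
qed

lemma prob_jump: "0 \<le> s \<Longrightarrow> \<P>(\<omega> in M. B (s + 1) \<omega> - B s \<omega> \<in> {2..}) = jump_prob"
  using prob_increment_eq[of s "s + 1" "{2..}"] by (simp add: jump_prob_def)

lemma prob_touch:
  assumes k: "1 \<le> k"
  shows "prob (touch j k) = jump_prob * \<P>(\<omega> in M. B k \<omega> - B 0 \<omega> \<in> {j - 1..j})"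
proof -
  define ts :: "nat \<Rightarrow> real" where "ts i = (if i = 0 then 0 else if i = 1 then real k else real k + 1)" for i
  let ?Z = "\<lambda>\<omega>. \<lambda>i\<in>{..<1}. B (ts (Suc i)) \<omega> - B (ts i) \<omega>"
  let ?A = "{f \<in> space (PiM {..<1} (\<lambda>_. borel)). f 0 \<in> {j - 1..j}}"
  have "?A \<in> sets (PiM {..<1::nat} (\<lambda>_. borel))" by measurable
  moreover have "ts i < ts (Suc i)" if "i \<le> 1" for i using that k by (cases i) (auto simp: ts_def)
  ultimately have "\<P>(\<omega> in M. ?Z \<omega> \<in> ?A \<and> B (ts (Suc 1)) \<omega> - B (ts 1) \<omega> \<in> {2..})
      = \<P>(\<omega> in M. ?Z \<omega> \<in> ?A) * \<P>(\<omega> in M. B (ts (Suc 1)) \<omega> - B (ts 1) \<omega> \<in> {2..})"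
    by (intro prob_indep_increment) (auto simp: ts_def)
  moreover have "\<P>(\<omega> in M. B (ts (Suc 1)) \<omega> - B (ts 1) \<omega> \<in> {2..}) = jump_prob"
    using prob_jump[of "real k"] by (simp add: ts_def)
  moreover have "\<P>(\<omega> in M. ?Z \<omega> \<in> ?A \<and> B (ts (Suc 1)) \<omega> - B (ts 1) \<omega> \<in> {2..}) = prob (touch j k)"
    by (intro arg_cong[where f=prob]) (auto simp: touch_def ts_def space_PiM)
  moreover have "\<P>(\<omega> in M. ?Z \<omega> \<in> ?A) = \<P>(\<omega> in M. B k \<omega> - B 0 \<omega> \<in> {j - 1..j})"
    by (intro arg_cong[where f=prob]) (auto simp: ts_def space_PiM)
  ultimately show ?thesis by (simp only: mult.commute)
qed

lemma prob_touch_le: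
  assumes k: "1 \<le> k"
  shows "prob (touch j k) \<le> rate / sqrt k"
proof -
  have "jump_prob * \<P>(\<omega> in M. B k \<omega> - B 0 \<omega> \<in> {j - 1..j}) \<le> jump_prob * ((j - (j - 1)) / (sqrt (2 * pi) * sqrt (real k - 0)))"
    using k jump_prob_pos by (intro mult_left_mono prob_increment_le) auto
  then show ?thesis using k by (simp add: prob_touch rate_def)
qed

lemma prob_touch_ge:
  assumes k: "1 \<le> k"
  shows "rate / sqrt k * (1 - (\<bar>j\<bar> + 1)\<^sup>2 / (2 * real k)) \<le> prob (touch j k)"
proof -
  have "jump_prob * ((j - (j - 1)) / (sqrt (2 * pi) * sqrt (real k - 0)) * (1 - (\<bar>j\<bar> + 1)\<^sup>2 / (2 * (real k - 0))))
     \<le> jump_prob * \<P>(\<omega> in M. B k \<omega> - B 0 \<omega> \<in> {j - 1..j})"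
    using k jump_prob_pos by (intro mult_left_mono prob_increment_ge) auto
  then show ?thesis using k by (simp add: prob_touch rate_def)
qed

text \<open>On the grid 0, \<open>k\<close>, \<open>k + 1\<close>, \<open>l\<close>,
  \<open>l + 1\<close> the last increment is the second jump, independent of the rest. The increment
  over the gap \<open>l - k - 1\<close> has to bring the path back to an interval of length one,
  which the density bound controls. The constant \<open>rate\<close> is kept exact because the
  variance estimate depends on it.\<close>

lemma prob_touch_pair:
  assumes k: "1 \<le> k" "k + 1 < l"
  shows "prob (touch j k \<inter> touch j l) \<le> prob (touch j k) * (rate / sqrt (real l - real k - 1))"
proof -
  define ts :: "nat \<Rightarrow> real" where
    "ts i = (if i = 0 then 0 else if i = 1 then real k else if i = 2 then real k + 1
             else if i = 3 then real l else real l + 1)" for i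
  let ?Z = "\<lambda>m \<omega>. \<lambda>i\<in>{..<m}. B (ts (Suc i)) \<omega> - B (ts i) \<omega>"
  let ?A2 = "{f \<in> space (PiM {..<2} (\<lambda>_. borel)). f 0 \<in> {j - 1..j} \<and> 2 \<le> f 1}"
  \<comment> \<open>Here \<open>f 0 + f 1 + f 2\<close> is the displacement at time
    \<open>l\<close>.\<close>
  let ?A3 = "{f \<in> space (PiM {..<3} (\<lambda>_. borel)). f 0 \<in> {j - 1..j} \<and> 2 \<le> f 1 \<and> f 0 + f 1 + f 2 \<in> {j - 1..j}}"
  have A2: "?A2 \<in> sets (PiM {..<2::nat} (\<lambda>_. borel))" by measurable
  have A3: "?A3 \<in> sets (PiM {..<3::nat} (\<lambda>_. borel))" by measurable
  have "real k + 1 < real l" using k by linarith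
  then have ts: "ts i < ts (Suc i)" if "i \<le> 3" for i
    using that k by (auto simp: ts_def numeral_eq_Suc le_Suc_eq)
  have ts0: "ts 0 = 0" "ts (Suc 0) = real k" "ts (Suc (Suc 0)) = real k + 1" "ts 2 = real k + 1" "ts 3 = real l"
    "ts (Suc 2) = real l" "ts (Suc 3) = real l + 1" "ts 4 = real l + 1"
    by (auto simp: ts_def)
  have Z3: "?Z 3 \<omega> 0 = B k \<omega> - B 0 \<omega>" "?Z 3 \<omega> 1 = B (real k + 1) \<omega> - B k \<omega>"
    "?Z 3 \<omega> 2 = B l \<omega> - B (real k + 1) \<omega>" "?Z 2 \<omega> 0 = B k \<omega> - B 0 \<omega>" "?Z 2 \<omega> 1 = B (real k + 1) \<omega> - B k \<omega>" for \<omega>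
    by (auto simp: ts0)
  have sp: "?Z m \<omega> \<in> space (PiM {..<m} (\<lambda>_. borel))" for m \<omega> by (simp add: space_PiM)
  have e1: "prob (touch j k \<inter> touch j l) =
      \<P>(\<omega> in M. ?Z 3 \<omega> \<in> ?A3 \<and> B (ts (Suc 3)) \<omega> - B (ts 3) \<omega> \<in> {2..})"
    unfolding mem_Collect_eq Z3 by (intro arg_cong[where f=prob]) (auto simp: touch_def ts0 sp)
  have e2: "\<P>(\<omega> in M. ?Z 3 \<omega> \<in> ?A3 \<and> B (ts (Suc 3)) \<omega> - B (ts 3) \<omega> \<in> {2..}) =
      \<P>(\<omega> in M. ?Z 3 \<omega> \<in> ?A3) * \<P>(\<omega> in M. B (ts (Suc 3)) \<omega> - B (ts 3) \<omega> \<in> {2..})"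
    by (intro prob_indep_increment A3 ts) (auto simp: ts0)
  have e3: "\<P>(\<omega> in M. B (ts (Suc 3)) \<omega> - B (ts 3) \<omega> \<in> {2..}) = jump_prob"
    using prob_jump[of "real l"] by (simp add: ts0)
  have e4: "\<P>(\<omega> in M. ?Z 3 \<omega> \<in> ?A3) =
      \<P>(\<omega> in M. ?Z 2 \<omega> \<in> ?A2 \<and> (\<lambda>f. f 0 + f 1) (?Z 2 \<omega>) + (B (ts (Suc 2)) \<omega> - B (ts 2) \<omega>) \<in> {j - 1..j})"
    unfolding mem_Collect_eq Z3 by (intro arg_cong[where f=prob]) (auto simp: ts0 sp)
  have e5: "\<P>(\<omega> in M. ?Z 2 \<omega> \<in> ?A2 \<and> (\<lambda>f. f 0 + f 1) (?Z 2 \<omega>) + (B (ts (Suc 2)) \<omega> - B (ts 2) \<omega>) \<in> {j - 1..j})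
    \<le> (j - (j - 1)) / (sqrt (2 * pi) * sqrt (ts (Suc 2) - ts 2)) * \<P>(\<omega> in M. ?Z 2 \<omega> \<in> ?A2)"
    by (intro prob_indep_increment_le A2 ts) (auto simp: ts0)
  have e6: "\<P>(\<omega> in M. ?Z 2 \<omega> \<in> ?A2) = prob (touch j k)"
    unfolding mem_Collect_eq Z3 by (intro arg_cong[where f=prob]) (auto simp: touch_def sp)
  have "prob (touch j k \<inter> touch j l) \<le>
      ((j - (j - 1)) / (sqrt (2 * pi) * sqrt (ts (Suc 2) - ts 2)) * prob (touch j k)) * jump_prob"
    unfolding e1 e2 e3 e4 using jump_prob_pos by (intro mult_right_mono) (use e5 in \<open>simp only: e6\<close>, simp)
  then show ?thesis
    by (simp add: ts0 rate_def algebra_simps)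
qed

end

subsection \<open>Divergence below dimension one half\<close>

lemma sum_symmetric:
  fixes f :: "nat \<Rightarrow> nat \<Rightarrow> real"
  assumes "\<And>k l. f k l = f l k"
  shows "(\<Sum>k=1..<n. \<Sum>l=1..<n. f k l) = (\<Sum>k=1..<n. f k k) + 2 * (\<Sum>k=1..<n. \<Sum>l=Suc k..<n. f k l)"
proof -
  let ?A = "{1..<n}"
  have "(\<Sum>k=1..<n. \<Sum>l=1..<n. f k l) =
      (\<Sum>k\<in>?A. f k k + (\<Sum>l\<in>{Suc k..<n}. f k l) + (\<Sum>l\<in>{1..<k}. f k l))"
  proof (rule sum.cong)
    fix k assume k: "k \<in> {1..<n}"
    have "{1..<n} = insert k ({Suc k..<n} \<union> {1..<k})" using k by auto
    then have "(\<Sum>l=1..<n. f k l) = (\<Sum>l\<in>insert k ({Suc k..<n} \<union> {1..<k}). f k l)" by simp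
    also have "\<dots> = f k k + (\<Sum>l\<in>{Suc k..<n} \<union> {1..<k}. f k l)" by (rule sum.insert) auto
    also have "(\<Sum>l\<in>{Suc k..<n} \<union> {1..<k}. f k l) = (\<Sum>l\<in>{Suc k..<n}. f k l) + (\<Sum>l\<in>{1..<k}. f k l)"
      by (rule sum.union_disjoint) auto
    finally show "(\<Sum>l=1..<n. f k l) = f k k + (\<Sum>l\<in>{Suc k..<n}. f k l) + (\<Sum>l\<in>{1..<k}. f k l)" by simp
  qed simp
  also have "\<dots> = (\<Sum>k\<in>?A. f k k) + (\<Sum>k\<in>?A. \<Sum>l\<in>{Suc k..<n}. f k l) + (\<Sum>k\<in>?A. \<Sum>l\<in>{1..<k}. f k l)"
    by (simp add: sum.distrib)
  also have "(\<Sum>k\<in>?A. \<Sum>l\<in>{1..<k}. f k l) = (\<Sum>k\<in>?A. \<Sum>l\<in>{l\<in>?A. l < k}. f k l)"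
    by (intro sum.cong) auto
  also have "\<dots> = (\<Sum>l\<in>?A. \<Sum>k\<in>{k\<in>?A. l < k}. f k l)"
    by (rule sum.swap_restrict) auto
  also have "\<dots> = (\<Sum>l\<in>?A. \<Sum>k\<in>{Suc l..<n}. f l k)"
    using assms by (intro sum.cong) auto
  finally show ?thesis by simp
qed

lemma sum_inverse_squares_le: "(\<Sum>k=1..<n. 1 / (real k)\<^sup>2) \<le> 2"
proof -
  \<comment> \<open>The correction \<open>1 / n\<close> makes the induction telescope, since
    \<open>1 / (n * Suc n) = 1 / n - 1 / Suc n\<close>.\<close>
  have "(\<Sum>k=1..<Suc n. 1 / (real k)\<^sup>2) \<le> 2 - 1 / real n" if "1 \<le> n" for n
    using that
  proof (induction n rule: dec_induct)
    case (step n)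
    then have n: "0 < real n" by simp
    have "1 / (real (Suc n))\<^sup>2 \<le> 1 / (real n * real (Suc n))"
      using n by (intro divide_left_mono) (auto simp: power2_eq_square)
    also have "\<dots> = 1 / real n - 1 / real (Suc n)" using n by (simp add: field_simps)
    finally show ?case using step.IH by simp
  qed simp
  note * = this
  show ?thesis
  proof (cases "2 \<le> n")
    case True
    then have "(\<Sum>k=1..<Suc (n - 1). 1 / (real k)\<^sup>2) \<le> 2 - 1 / real (n - 1)" by (intro *) simp
    also have "\<dots> \<le> 2" by simp
    finally show ?thesis using True by simp
  next
    case False
    then have "n = 0 \<or> n = 1" by linarith
    then show ?thesis by auto
  qed
qed

lemma sum_dyadic_blocks:
  fixes f :: "nat \<Rightarrow> real"
  shows "(\<Sum>k=1..<2 ^ N. f k) = (\<Sum>n=1..N. \<Sum>k=2 ^ (n - 1)..<2 ^ n. f k)"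
proof (induction N)
  case (Suc N)
  have "(\<Sum>k=1..<2 ^ N. f k) + (\<Sum>k=2 ^ N..<2 ^ Suc N. f k) = (\<Sum>k=1..<2 ^ Suc N. f k)"
    by (rule sum.atLeastLessThan_concat) auto
  then show ?case using Suc by simp
qed simp

text \<open>A block of \<open>2 ^ m\<close> terms, each at least \<open>1 / 2 ^ Suc m\<close>,
  contributes one half. This gives the linear growth in \<open>N\<close> of the mean total
  weight.\<close>

lemma harmonic_dyadic_ge: "real N / 2 \<le> (\<Sum>k=1..<2 ^ N. 1 / real k)"
proof -
  have "real N / 2 = (\<Sum>n=1..N. 1 / 2)" by simp
  also have "\<dots> \<le> (\<Sum>n=1..N. \<Sum>k=2 ^ (n - 1)..<2 ^ n. 1 / real k)"
  proof (intro sum_mono)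
    fix n assume "n \<in> {1..N}"
    then obtain m where m: "n = Suc m" by (cases n) auto
    have "(1 / 2 :: real) = (\<Sum>k\<in>{2 ^ m..<2 ^ Suc m::nat}. 1 / real (2 ^ Suc m))" by simp
    also have "\<dots> \<le> (\<Sum>k=2 ^ m..<2 ^ Suc m. 1 / real k)"
    proof (intro sum_mono divide_left_mono)
      fix k assume k: "k \<in> {2 ^ m..<2 ^ Suc m::nat}"
      then show "real k \<le> real (2 ^ Suc m)" by (intro of_nat_mono) auto
      have "0 < k" using k by (auto intro: less_le_trans[of 0 "2 ^ m"])
      then show "0 < real (2 ^ Suc m) * real k" by simp
    qed simp
    finally show "1 / 2 \<le> (\<Sum>k=2 ^ (n - 1)..<2 ^ n. 1 / real k)" using m by simp
  qed
  also have "\<dots> = (\<Sum>k=1..<2 ^ N. 1 / real k)" by (rule sum_dyadic_blocks[symmetric])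
  finally show ?thesis .
qed

text \<open>The sum is split at \<open>k\<close>; on either side the distances plus one are distinct
  integers between 1 and \<open>N\<close>, so \<open>sum_powr_le\<close> applies twice.\<close>

lemma sum_powr_distance_le:
  assumes "0 < t" "t < 1" "k \<in> {N..<2 * N}"
  shows "(\<Sum>l=N..<2 * N. (\<bar>real k - real l\<bar> + 1) powr (t - 1)) \<le> 2 * (real N powr t / t)"
proof -
  have "(\<Sum>l=N..<2 * N. (\<bar>real k - real l\<bar> + 1) powr (t - 1)) =
      (\<Sum>l\<in>{N..<k} \<union> {k..<2 * N}. (\<bar>real k - real l\<bar> + 1) powr (t - 1))"
    using assms(3) by (intro sum.cong) auto
  also have "\<dots> = (\<Sum>l=N..<k. (\<bar>real k - real l\<bar> + 1) powr (t - 1)) +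
      (\<Sum>l=k..<2 * N. (\<bar>real k - real l\<bar> + 1) powr (t - 1))"
    by (rule sum.union_disjoint) auto
  also have "\<dots> \<le> (\<Sum>m=1..N. real m powr (t - 1)) + (\<Sum>m=1..N. real m powr (t - 1))"
  proof (intro add_mono)
    have "(\<Sum>l=N..<k. (\<bar>real k - real l\<bar> + 1) powr (t - 1)) = (\<Sum>m=2..k - N + 1. real m powr (t - 1))"
      by (rule sum.reindex_bij_witness[where i="\<lambda>m. k + 1 - m" and j="\<lambda>l. k + 1 - l"])
        (use assms(3) in \<open>auto simp: of_nat_diff algebra_simps\<close>)
    also have "\<dots> \<le> (\<Sum>m=1..N. real m powr (t - 1))"
      using assms(3) by (intro sum_mono2) auto
    finally show "(\<Sum>l=N..<k. (\<bar>real k - real l\<bar> + 1) powr (t - 1)) \<le> (\<Sum>m=1..N. real m powr (t - 1))" .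
    have "(\<Sum>l=k..<2 * N. (\<bar>real k - real l\<bar> + 1) powr (t - 1)) = (\<Sum>m=1..2 * N - k. real m powr (t - 1))"
      by (rule sum.reindex_bij_witness[where i="\<lambda>m. m + k - 1" and j="\<lambda>l. l + 1 - k"])
        (use assms(3) in \<open>auto simp: of_nat_diff algebra_simps\<close>)
    also have "\<dots> \<le> (\<Sum>m=1..N. real m powr (t - 1))"
      using assms(3) by (intro sum_mono2) auto
    finally show "(\<Sum>l=k..<2 * N. (\<bar>real k - real l\<bar> + 1) powr (t - 1)) \<le> (\<Sum>m=1..N. real m powr (t - 1))" .
  qed
  also have "\<dots> \<le> 2 * (real N powr t / t)" using sum_powr_le[OF assms(1,2), of N] by simp
  finally show ?thesis .
qed

section \<open>Moments of the weights and of their energy\<close>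

context brownian_motion
begin

text \<open>For large \<open>k\<close> the event has probability of order \<open>1 / sqrt k\<close>,
  so this factor makes the mean weight of order \<open>1 / k\<close> and the mean mass of a shell of
  order one.\<close>

definition weight :: "real \<Rightarrow> nat \<Rightarrow> 'a \<Rightarrow> real" where
  "weight j k \<omega> = indicator (touch j k) \<omega> / sqrt k"

lemma weight_nonneg: "0 \<le> weight j k \<omega>"
  by (simp add: weight_def)

lemma measurable_weight [measurable]: "weight j k \<in> borel_measurable M"
  unfolding weight_def by measurable

lemma integrable_indicator_event [simp]: "A \<in> sets M \<Longrightarrow> integrable M (indicator A :: 'a \<Rightarrow> real)"
  by (simp add: integrable_indicator_iff emeasure_eq_measure)

lemma integrable_weight [simp]: "integrable M (weight j k)"
  unfolding weight_def by (intro integrable_divide) simp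

lemma expectation_weight: "expectation (weight j k) = prob (touch j k) / sqrt k"
  unfolding weight_def by simp

lemma weight_mult:
  "weight j k \<omega> * weight j l \<omega> = indicator (touch j k \<inter> touch j l) \<omega> / (sqrt k * sqrt l)"
  by (simp add: weight_def indicator_inter_arith)

lemma integrable_weight_mult [simp]: "integrable M (\<lambda>\<omega>. weight j k \<omega> * weight j l \<omega>)"
  unfolding weight_mult by (intro integrable_divide) simp

lemma expectation_weight_mult:
  "expectation (\<lambda>\<omega>. weight j k \<omega> * weight j l \<omega>) = prob (touch j k \<inter> touch j l) / (sqrt k * sqrt l)"
  unfolding weight_mult by simp

text \<open>The leading terms form \<open>rate\<close> times the harmonic sum; the errors are of
  order \<open>1 / k^2\<close> and cost only a constant depending on \<open>j\<close>.\<close>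

lemma expectation_sum_weight_ge:
  "rate * ((\<Sum>k=1..<n. 1 / real k) - (\<bar>j\<bar> + 1)\<^sup>2) \<le> expectation (\<lambda>\<omega>. \<Sum>k=1..<n. weight j k \<omega>)"
proof -
  define c where "c = (\<bar>j\<bar> + 1)\<^sup>2 / 2"
  have "rate * (\<Sum>k=1..<n. 1 / real k) - rate * c * (\<Sum>k=1..<n. 1 / (real k)\<^sup>2)
      = (\<Sum>k=1..<n. rate / real k - rate * c / (real k)\<^sup>2)"
    by (simp add: sum_distrib_left sum_subtractf)
  also have "\<dots> \<le> (\<Sum>k=1..<n. expectation (weight j k))"
  proof (intro sum_mono)
    fix k assume "k \<in> {1..<n}"
    then have k: "1 \<le> k" by simp
    have "rate / sqrt k * (1 - (\<bar>j\<bar> + 1)\<^sup>2 / (2 * real k)) / sqrt k \<le> prob (touch j k) / sqrt k"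
      by (rule divide_right_mono[OF prob_touch_ge[OF k]]) simp
    moreover have "rate / sqrt k * (1 - (\<bar>j\<bar> + 1)\<^sup>2 / (2 * real k)) / sqrt k =
        rate * (1 - (\<bar>j\<bar> + 1)\<^sup>2 / (2 * real k)) / (sqrt k * sqrt k)" by simp
    moreover have "\<dots> = rate / real k - rate * c / (real k)\<^sup>2"
      using k by (simp add: c_def field_simps power2_eq_square)
    ultimately show "rate / real k - rate * c / (real k)\<^sup>2 \<le> expectation (weight j k)"
      by (simp add: expectation_weight)
  qed
  also have "\<dots> = expectation (\<lambda>\<omega>. \<Sum>k=1..<n. weight j k \<omega>)" by simp
  finally have "rate * (\<Sum>k=1..<n. 1 / real k) - rate * c * (\<Sum>k=1..<n. 1 / (real k)\<^sup>2)
      \<le> expectation (\<lambda>\<omega>. \<Sum>k=1..<n. weight j k \<omega>)" .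
  moreover have "rate * c * (\<Sum>k=1..<n. 1 / (real k)\<^sup>2) \<le> rate * c * 2"
    using rate_pos sum_inverse_squares_le by (intro mult_left_mono) (auto simp: c_def)
  ultimately show ?thesis by (simp add: c_def algebra_simps)
qed

text \<open>The coefficient of \<open>H^2\<close> is the square of the one in the mean, so the
  variance is only linear in \<open>H\<close>. This holds because passing from
  \<open>1 / sqrt (l * (l - k - 1))\<close> to \<open>1 / l\<close> costs at most
  \<open>2 / k\<close> for each \<open>k\<close>.\<close>

lemma expectation_sum_weight_square_le:
  fixes n :: nat
  defines "H \<equiv> (\<Sum>k=1..<n. 1 / real k)"
  shows "expectation (\<lambda>\<omega>. (\<Sum>k=1..<n. weight j k \<omega>)\<^sup>2) \<le> rate\<^sup>2 * H\<^sup>2 + 7 * H"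
proof -
  define f where "f k l = prob (touch j k \<inter> touch j l) / (sqrt k * sqrt l)" for k l
  have sym: "f k l = f l k" for k l by (simp add: f_def Int_commute mult.commute)
  have "expectation (\<lambda>\<omega>. (\<Sum>k=1..<n. weight j k \<omega>)\<^sup>2) =
      expectation (\<lambda>\<omega>. \<Sum>k=1..<n. \<Sum>l=1..<n. weight j k \<omega> * weight j l \<omega>)"
    by (simp add: power2_eq_square sum_product)
  also have "\<dots> = (\<Sum>k=1..<n. \<Sum>l=1..<n. f k l)"
    by (simp add: f_def expectation_weight_mult)
  also have "\<dots> = (\<Sum>k=1..<n. f k k) + 2 * (\<Sum>k=1..<n. \<Sum>l=Suc k..<n. f k l)"
    by (rule sum_symmetric) (rule sym)
  \<comment> \<open>For each \<open>k\<close> the excess is \<open>2 / k\<close> from the comparison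
    with \<open>1 / l\<close> and \<open>1 / k\<close> from \<open>l = k + 1\<close>. Doubled and
    added to the diagonal this becomes \<open>7 * H\<close>.\<close>
  also have "\<dots> \<le> H + 2 * (\<Sum>k=1..<n. rate\<^sup>2 * (\<Sum>l=Suc k..<n. 1 / real k * (1 / real l)) + 3 * (1 / real k))"
  proof (intro add_mono mult_left_mono sum_mono)
    show "(\<Sum>k=1..<n. f k k) \<le> H"
      unfolding H_def f_def by (intro sum_mono) (simp add: divide_right_mono)
    fix k assume "k \<in> {1..<n}"
    then have k: "1 \<le> k" "k < n" by auto
    have tail: "f k l \<le> rate\<^sup>2 / real k * (1 / sqrt (real l * (real l - real k - 1)))" if "k + 1 < l" for l
    proof -
      have "f k l \<le> (prob (touch j k) * (rate / sqrt (real l - real k - 1))) / (sqrt k * sqrt l)"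
        unfolding f_def by (intro divide_right_mono prob_touch_pair k that) simp
      also have "\<dots> \<le> ((rate / sqrt k) * (rate / sqrt (real l - real k - 1))) / (sqrt k * sqrt l)"
        using rate_pos that by (intro divide_right_mono mult_right_mono prob_touch_le k) auto
      also have "\<dots> = rate\<^sup>2 / (sqrt k * sqrt k) * (1 / (sqrt l * sqrt (real l - real k - 1)))"
        by (simp add: power2_eq_square)
      finally show ?thesis by (simp add: real_sqrt_mult)
    qed
    have "(\<Sum>l=Suc (Suc k)..<n. 1 / sqrt (real l * (real l - real k - 1)) - 1 / real l) \<le> 2"
    proof -
      have "(\<Sum>l=Suc (Suc k)..<n. 1 / sqrt (real l * (real l - real k - 1)) - 1 / real l)
        = (\<Sum>m=1..n - k - 2. 1 / sqrt (real (m + (k + 1)) * real m) - 1 / real (m + (k + 1)))"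
        by (rule sum.reindex_bij_witness[where i="\<lambda>m. m + (k + 1)" and j="\<lambda>l. l - (k + 1)"]) (auto simp: of_nat_diff)
      also have "\<dots> \<le> 2" by (rule sum_inverse_sqrt_diff_le)
      finally show ?thesis .
    qed
    then have A: "(\<Sum>l=Suc (Suc k)..<n. 1 / sqrt (real l * (real l - real k - 1))) \<le> (\<Sum>l=Suc (Suc k)..<n. 1 / real l) + 2"
      by (simp add: sum_subtractf)
    have B: "(\<Sum>l=Suc (Suc k)..<n. 1 / real l) \<le> (\<Sum>l=Suc k..<n. 1 / real l)"
      by (rule sum_mono2) auto
    have "(\<Sum>l=Suc (Suc k)..<n. f k l) \<le> (\<Sum>l=Suc (Suc k)..<n. rate\<^sup>2 / real k * (1 / sqrt (real l * (real l - real k - 1))))"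
      by (intro sum_mono tail) auto
    also have "\<dots> = rate\<^sup>2 / real k * (\<Sum>l=Suc (Suc k)..<n. 1 / sqrt (real l * (real l - real k - 1)))"
      by (rule sum_distrib_left[symmetric])
    also have "\<dots> \<le> rate\<^sup>2 / real k * ((\<Sum>l=Suc k..<n. 1 / real l) + 2)"
      using A B by (intro mult_left_mono) auto
    also have "\<dots> = rate\<^sup>2 * (\<Sum>l=Suc k..<n. 1 / real k * (1 / real l)) + rate\<^sup>2 * 2 * (1 / real k)"
      unfolding sum_distrib_left[symmetric] by (simp add: algebra_simps)
    also have "\<dots> \<le> rate\<^sup>2 * (\<Sum>l=Suc k..<n. 1 / real k * (1 / real l)) + 2 * (1 / real k)"
    proof -
      have "rate\<^sup>2 \<le> 1" using rate_pos rate_le_1 by (simp add: power_le_one)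
      then show ?thesis by (intro add_left_mono mult_right_mono) auto
    qed
    finally have C: "(\<Sum>l=Suc (Suc k)..<n. f k l) \<le> rate\<^sup>2 * (\<Sum>l=Suc k..<n. 1 / real k * (1 / real l)) + 2 * (1 / real k)" .
    \<comment> \<open>For \<open>l = k + 1\<close> no time passes between the first jump and
      \<open>l\<close>, so only the trivial bound 1 on the probability is available.\<close>
    have next1: "f k (Suc k) \<le> 1 / real k"
    proof -
      have "f k (Suc k) \<le> 1 / (sqrt k * sqrt k)"
        unfolding f_def using k by (intro frac_le mult_left_mono) auto
      then show ?thesis by simp
    qed
    show "(\<Sum>l=Suc k..<n. f k l) \<le> rate\<^sup>2 * (\<Sum>l=Suc k..<n. 1 / real k * (1 / real l)) + 3 * (1 / real k)"
    proof (cases "Suc k < n")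
      case True
      then have "(\<Sum>l=Suc k..<n. f k l) = f k (Suc k) + (\<Sum>l=Suc (Suc k)..<n. f k l)"
        by (rule sum.atLeast_Suc_lessThan)
      then show ?thesis using C next1 by simp
    next
      case False
      then show ?thesis by simp
    qed
  qed simp
  also have "\<dots> = rate\<^sup>2 * (2 * (\<Sum>k=1..<n. \<Sum>l=Suc k..<n. 1 / real k * (1 / real l))) + 7 * H"
    unfolding sum.distrib sum_distrib_left[symmetric] H_def[symmetric] by (simp add: algebra_simps)
  also have "\<dots> \<le> rate\<^sup>2 * H\<^sup>2 + 7 * H"
  proof (intro add_right_mono mult_left_mono)
    \<comment> \<open>Twice the sum over \<open>k < l\<close> is \<open>H^2\<close> without its
      nonnegative diagonal.\<close>
    have "H\<^sup>2 = (\<Sum>k=1..<n. \<Sum>l=1..<n. 1 / real k * (1 / real l))"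
      by (simp add: H_def power2_eq_square sum_product)
    also have "\<dots> = (\<Sum>k=1..<n. 1 / real k * (1 / real k)) + 2 * (\<Sum>k=1..<n. \<Sum>l=Suc k..<n. 1 / real k * (1 / real l))"
      by (rule sum_symmetric) simp
    finally have *: "H\<^sup>2 = (\<Sum>k=1..<n. 1 / real k * (1 / real k)) + 2 * (\<Sum>k=1..<n. \<Sum>l=Suc k..<n. 1 / real k * (1 / real l))" .
    have "0 \<le> (\<Sum>k=1..<n. 1 / real k * (1 / real k))" by (intro sum_nonneg) auto
    then show "2 * (\<Sum>k=1..<n. \<Sum>l=Suc k..<n. 1 / real k * (1 / real l)) \<le> H\<^sup>2" using * by linarith
  qed simp
  finally show ?thesis .
qed

text \<open>A Riesz kernel rescaled to the shell; the 1 added to the distance reflects the unit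
  resolution and keeps the diagonal finite.\<close>

definition energy :: "real \<Rightarrow> real \<Rightarrow> nat \<Rightarrow> 'a \<Rightarrow> real" where
  "energy \<rho> j n \<omega> = (\<Sum>k=2 ^ (n - 1)..<2 ^ n. \<Sum>l=2 ^ (n - 1)..<2 ^ n.
     weight j k \<omega> * weight j l \<omega> * (2 ^ n / (\<bar>real k - real l\<bar> + 1)) powr \<rho>)"

lemma energy_nonneg: "0 \<le> energy \<rho> j n \<omega>"
  unfolding energy_def by (intro sum_nonneg mult_nonneg_nonneg weight_nonneg) auto

lemma measurable_energy [measurable]: "energy \<rho> j n \<in> borel_measurable M"
  unfolding energy_def by measurable

lemma integrable_energy [simp]: "integrable M (energy \<rho> j n)"
  unfolding energy_def by simp

text \<open>Cruder than \<open>prob_touch_pair\<close>, but valid for equal and neighbouring points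
  too. The constant 2 comes from \<open>d + 1 \<le> 4 * (d - 1)\<close> when
  \<open>2 \<le> d\<close>, and from \<open>d + 1 \<le> 4\<close> otherwise.\<close>

lemma prob_touch_pair_le:
  assumes k: "1 \<le> k" "k \<le> l"
  shows "prob (touch j k \<inter> touch j l) \<le> 2 / (sqrt k * sqrt (\<bar>real k - real l\<bar> + 1))"
proof -
  have one: "prob (touch j k) \<le> 1 / sqrt k"
    using prob_touch_le[OF k(1), of j] divide_right_mono[OF rate_le_1, of "sqrt k"] by simp
  have "prob (touch j k \<inter> touch j l) \<le> 1 / sqrt k * (2 / sqrt (\<bar>real k - real l\<bar> + 1))"
  proof (cases "k + 1 < l")
    case True
    define d where "d = real l - real k"
    have d: "2 \<le> d" using True by (simp add: d_def)
    have "prob (touch j k \<inter> touch j l) \<le> prob (touch j k) * (rate / sqrt (real l - real k - 1))"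
      by (rule prob_touch_pair[OF k(1) True])
    also have "\<dots> \<le> 1 / sqrt k * (2 / sqrt (d + 1))"
    proof (intro mult_mono one)
      have "sqrt (d + 1) \<le> sqrt (4 * (d - 1))" using d by (intro real_sqrt_le_mono) simp
      also have "\<dots> = 2 * sqrt (d - 1)" by (simp only: real_sqrt_mult real_sqrt_four)
      finally have "1 / (2 * sqrt (d - 1)) \<le> 1 / sqrt (d + 1)"
        using d by (intro divide_left_mono) auto
      moreover have "rate / sqrt (d - 1) \<le> 1 / sqrt (d - 1)"
        using d rate_le_1 by (intro divide_right_mono) auto
      ultimately show "rate / sqrt (real l - real k - 1) \<le> 2 / sqrt (d + 1)"
        by (simp add: d_def)
      show "0 \<le> rate / sqrt (real l - real k - 1)"
        using d rate_pos by (simp add: d_def)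
    qed simp
    finally show ?thesis using d by (simp add: d_def)
  next
    case False
    then have "real l \<le> real (k + 1)" by (intro of_nat_mono) simp
    then have "\<bar>real k - real l\<bar> + 1 \<le> 4" using k by simp
    then have "sqrt (\<bar>real k - real l\<bar> + 1) \<le> sqrt 4" by (intro real_sqrt_le_mono)
    then have "1 \<le> 2 / sqrt (\<bar>real k - real l\<bar> + 1)" by (subst le_divide_eq) auto
    have "prob (touch j k \<inter> touch j l) \<le> prob (touch j k)" by (intro finite_measure_mono) auto
    also have "\<dots> \<le> 1 / sqrt k * 1" using one by simp
    also have "\<dots> \<le> 1 / sqrt k * (2 / sqrt (\<bar>real k - real l\<bar> + 1))"
      by (intro mult_left_mono) (fact, simp)
    finally show ?thesis .
  qed
  then show ?thesis by simp
qed

text \<open>With \<open>N = 2 ^ (n - 1)\<close>, pair moments are at most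
  \<open>2 * N powr (- 3 / 2)\<close> times the distance plus one to the power
  \<open>- 1 / 2\<close>. After multiplication by the kernel the sum over \<open>l\<close> is of
  order \<open>N powr t / t\<close> with \<open>t = 1 / 2 - \<rho>\<close>, which is where
  \<open>\<rho> < 1 / 2\<close> enters. All powers of \<open>N\<close> cancel, so the bound is
  uniform in \<open>n\<close> and \<open>j\<close>.\<close>

lemma expectation_energy_le:
  assumes \<rho>: "0 < \<rho>" "\<rho> < 1 / 2" and n: "1 \<le> n"
  shows "expectation (energy \<rho> j n) \<le> 8 / (1 / 2 - \<rho>)"
proof -
  define t where "t = 1 / 2 - \<rho>"
  define N :: nat where "N = 2 ^ (n - 1)"
  have N: "2 ^ n = 2 * N" "1 \<le> N" and N': "(2::real) ^ n = 2 * real N"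
    using n by (auto simp: N_def power_Suc[symmetric] simp del: power_Suc)
  have t: "0 < t" "t < 1" using \<rho> by (auto simp: t_def)
  define e where "e k l = prob (touch j k \<inter> touch j l) / (sqrt k * sqrt l)" for k l
  have e: "e k l \<le> 2 / (real N * sqrt N) * (\<bar>real k - real l\<bar> + 1) powr (- 1 / 2)"
    if "k \<in> {N..<2 * N}" "l \<in> {N..<2 * N}" for k l
  proof -
    \<comment> \<open>The pair bound is stated for ordered pairs; symmetry of \<open>e\<close> gives
      the others.\<close>
    have *: "e k l \<le> 2 / (real N * sqrt N) * (\<bar>real k - real l\<bar> + 1) powr (- 1 / 2)"
      if "N \<le> k" "k \<le> l" for k l
    proof -
      have Nk: "0 < sqrt N" "sqrt N \<le> sqrt k" "sqrt N \<le> sqrt l" "1 \<le> k" using that N by auto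
      have "e k l \<le> 2 / (sqrt k * sqrt (\<bar>real k - real l\<bar> + 1)) / (sqrt k * sqrt l)"
        unfolding e_def using that Nk by (intro divide_right_mono prob_touch_pair_le) auto
      also have "\<dots> = 2 / (sqrt k * (sqrt k * sqrt l)) * (1 / sqrt (\<bar>real k - real l\<bar> + 1))"
        by simp
      also have "\<dots> \<le> 2 / (sqrt N * (sqrt N * sqrt N)) * (1 / sqrt (\<bar>real k - real l\<bar> + 1))"
        using Nk by (intro mult_right_mono divide_left_mono mult_mono mult_pos_pos) auto
      also have "1 / sqrt (\<bar>real k - real l\<bar> + 1) = (\<bar>real k - real l\<bar> + 1) powr (- 1 / 2)"
        by (simp add: powr_half_sqrt[symmetric] powr_minus_divide)
      finally show ?thesis by (simp add: mult.commute)
    qed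
    have "e k l = e l k" "\<bar>real k - real l\<bar> = \<bar>real l - real k\<bar>"
      by (auto simp: e_def Int_commute mult.commute)
    then show ?thesis using *[of k l] *[of l k] that by (cases "k \<le> l") auto
  qed
  have "expectation (energy \<rho> j n) =
     (\<Sum>k=N..<2 * N. \<Sum>l=N..<2 * N. e k l * (2 * real N / (\<bar>real k - real l\<bar> + 1)) powr \<rho>)"
    unfolding energy_def N(1) N' N_def[symmetric] by (simp add: e_def expectation_weight_mult)
  also have "\<dots> \<le> (\<Sum>k=N..<2 * N. \<Sum>l=N..<2 * N.
      2 / (real N * sqrt N) * (2 * real N) powr \<rho> * (\<bar>real k - real l\<bar> + 1) powr (t - 1))"
  proof (intro sum_mono)
    fix k l assume kl: "k \<in> {N..<2 * N}" "l \<in> {N..<2 * N}"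
    define x where "x = \<bar>real k - real l\<bar> + 1"
    have x: "0 < x" by (simp add: x_def)
    have "e k l * (2 * real N / x) powr \<rho> \<le> (2 / (real N * sqrt N) * x powr (- 1 / 2)) * (2 * real N / x) powr \<rho>"
      using e[OF kl] by (intro mult_right_mono) (auto simp: x_def)
    also have "\<dots> = 2 / (real N * sqrt N) * (2 * real N) powr \<rho> * (x powr (- 1 / 2) / x powr \<rho>)"
      using x by (simp add: powr_divide)
    also have "x powr (- 1 / 2) / x powr \<rho> = x powr (t - 1)"
      unfolding powr_diff[symmetric] by (simp add: t_def)
    finally show "e k l * (2 * real N / (\<bar>real k - real l\<bar> + 1)) powr \<rho> \<le>
      2 / (real N * sqrt N) * (2 * real N) powr \<rho> * (\<bar>real k - real l\<bar> + 1) powr (t - 1)"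
      unfolding x_def .
  qed
  also have "\<dots> = (\<Sum>k=N..<2 * N. 2 / (real N * sqrt N) * (2 * real N) powr \<rho> *
      (\<Sum>l=N..<2 * N. (\<bar>real k - real l\<bar> + 1) powr (t - 1)))"
    by (simp add: sum_distrib_left)
  also have "\<dots> \<le> (\<Sum>k=N..<2 * N. 2 / (real N * sqrt N) * (2 * real N) powr \<rho> * (2 * (real N powr t / t)))"
    by (intro sum_mono mult_left_mono sum_powr_distance_le t) auto
  also have "\<dots> = real N * (2 / (real N * sqrt N) * (2 * real N) powr \<rho> * (2 * (real N powr t / t)))"
    by simp
  also have "\<dots> = 4 / t * 2 powr \<rho> * (real N powr \<rho> * real N powr t / sqrt N)"
    using N by (simp add: powr_mult ac_simps)
  also have "real N powr \<rho> * real N powr t / sqrt N = 1"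
    using N by (simp add: powr_add[symmetric] t_def powr_half_sqrt)
  also have "4 / t * 2 powr \<rho> * 1 \<le> 4 / t * 2 powr 1 * 1"
    using \<rho> t by (intro mult_right_mono mult_left_mono powr_mono) auto
  finally show ?thesis by (simp add: t_def)
qed

text \<open>The total weight \<open>T N\<close> has mean of order \<open>N\<close> and variance
  \<open>O(N)\<close>, while the energy \<open>J N\<close> has mean \<open>O(N)\<close>. Hence the
  reverse inequality at \<open>N\<close> has probability \<open>O(1 / N)\<close>, and it cannot hold
  for all \<open>N\<close> with positive probability.\<close>

lemma weight_energy_null:
  assumes \<rho>: "0 < \<rho>" "\<rho> < 1 / 2" and V: "0 < V"
  shows "AE \<omega> in M. \<exists>N. V * (\<Sum>n=1..N. energy \<rho> j n \<omega>) < (\<Sum>k=1..<2 ^ N. weight j k \<omega>)\<^sup>2"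
proof -
  define T where "T N \<omega> = (\<Sum>k=1..<2 ^ N. weight j k \<omega>)" for N \<omega>
  define J where "J N \<omega> = (\<Sum>n=1..N. energy \<rho> j n \<omega>)" for N \<omega>
  define h where "h N = (\<Sum>k=1..<2 ^ N. 1 / real k)" for N :: nat
  define c where "c = (\<bar>j\<bar> + 1)\<^sup>2"
  define C where "C = 8 / (1 / 2 - \<rho>)"
  have T_meas [measurable]: "T N \<in> borel_measurable M" for N unfolding T_def by measurable
  have J_meas [measurable]: "J N \<in> borel_measurable M" for N unfolding J_def by measurable
  have c: "0 \<le> c" by (simp add: c_def)
  have C: "0 < C" using \<rho> by (simp add: C_def)
  have T_int: "integrable M (T N)" for N unfolding T_def by simp
  have T2_int: "integrable M (\<lambda>\<omega>. (T N \<omega>)\<^sup>2)" for N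
    unfolding T_def power2_eq_square sum_product by simp
  have J_int: "integrable M (J N)" for N unfolding J_def by simp
  have J_nonneg: "0 \<le> J N \<omega>" for N \<omega> unfolding J_def by (intro sum_nonneg energy_nonneg)
  have EJ: "expectation (J N) \<le> C * real N" for N
  proof -
    have "expectation (J N) = (\<Sum>n=1..N. expectation (energy \<rho> j n))" unfolding J_def by simp
    also have "\<dots> \<le> (\<Sum>n=1..N. C)"
      unfolding C_def by (intro sum_mono expectation_energy_le \<rho>) auto
    finally show ?thesis by (simp add: mult.commute)
  qed
  \<comment> \<open>The constant collects the factors of the estimate below: 4 from Chebyshev at
    distance \<open>m / 2\<close>, \<open>8 * V * C\<close> from Markov with
    \<open>N \<le> 2 * h N\<close>, and \<open>4 / rate^2\<close> from
    \<open>m \<ge> rate * (h N / 2)\<close>.\<close>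
  define D where "D = (4 * (7 + 2 * c) + 8 * V * C) * 4 / rate\<^sup>2"
  have D: "0 \<le> D" using c C V by (simp add: D_def)
  define S where "S N = {\<omega> \<in> space M. (T N \<omega>)\<^sup>2 \<le> V * J N \<omega>}" for N
  have S_sets [measurable]: "S N \<in> sets M" for N unfolding S_def by measurable
  \<comment> \<open>The threshold gives \<open>2 * c \<le> h N\<close>, so the constant lost in the
    mean is at most half of \<open>h N\<close>.\<close>
  have bound: "prob (S N) \<le> D * 2 / real N" if N: "real N \<ge> 4 * c + 2" for N
  proof -
    have h: "real N / 2 \<le> h N" unfolding h_def by (rule harmonic_dyadic_ge)
    then have h2: "2 * c \<le> h N" "0 < h N" using N c by auto
    define m where "m = expectation (T N)"
    have m_ge: "rate * (h N - c) \<le> m"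
      unfolding m_def T_def h_def c_def by (rule expectation_sum_weight_ge)
    have m_half: "rate * (h N / 2) \<le> m"
    proof (rule order_trans[OF _ m_ge])
      show "rate * (h N / 2) \<le> rate * (h N - c)" using h2 rate_pos by (intro mult_left_mono) auto
    qed
    then have m_pos: "0 < m" using h2 rate_pos by (auto intro: less_le_trans[of 0 "rate * (h N / 2)"])
    have r1: "rate\<^sup>2 \<le> 1" using rate_pos rate_le_1 by (simp add: power_le_one)
    have "variance (T N) = expectation (\<lambda>\<omega>. (T N \<omega>)\<^sup>2) - m\<^sup>2"
      unfolding m_def by (rule variance_eq[OF T_int T2_int])
    also have "\<dots> \<le> (rate\<^sup>2 * (h N)\<^sup>2 + 7 * h N) - (rate * (h N - c))\<^sup>2"
    proof (intro diff_mono)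
      show "expectation (\<lambda>\<omega>. (T N \<omega>)\<^sup>2) \<le> rate\<^sup>2 * (h N)\<^sup>2 + 7 * h N"
        unfolding T_def h_def by (rule expectation_sum_weight_square_le)
      show "(rate * (h N - c))\<^sup>2 \<le> m\<^sup>2"
        using m_ge h2 c rate_pos by (intro power_mono) auto
    qed
    \<comment> \<open>The terms \<open>rate^2 * (h N)^2\<close> cancel, which leaves a bound linear
      in \<open>h N\<close>.\<close>
    also have "\<dots> = 7 * h N + rate\<^sup>2 * (2 * c * h N - c\<^sup>2)"
      by (simp add: power2_eq_square algebra_simps)
    also have "\<dots> \<le> 7 * h N + 1 * (2 * c * h N)"
    proof (intro add_left_mono mult_mono r1)
      have "c * c \<le> c * (2 * h N)" using c h2 by (intro mult_left_mono) auto
      then show "0 \<le> 2 * c * h N - c\<^sup>2" by (simp add: power2_eq_square algebra_simps)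
    qed auto
    finally have var: "variance (T N) \<le> (7 + 2 * c) * h N" by (simp add: algebra_simps)
    \<comment> \<open>Either the weight falls below half its mean, or the energy reaches
      \<open>m^2 / (4 * V)\<close>; these are handled by Chebyshev and by Markov.\<close>
    have "S N \<subseteq> {\<omega> \<in> space M. m / 2 \<le> \<bar>T N \<omega> - m\<bar>} \<union> {\<omega> \<in> space M. m\<^sup>2 / (4 * V) \<le> J N \<omega>}"
    proof
      fix \<omega> assume "\<omega> \<in> S N"
      then have \<omega>: "\<omega> \<in> space M" "(T N \<omega>)\<^sup>2 \<le> V * J N \<omega>" by (auto simp: S_def)
      show "\<omega> \<in> {\<omega> \<in> space M. m / 2 \<le> \<bar>T N \<omega> - m\<bar>} \<union> {\<omega> \<in> space M. m\<^sup>2 / (4 * V) \<le> J N \<omega>}"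
      proof (cases "T N \<omega> \<le> m / 2")
        case True
        then have "m / 2 \<le> \<bar>T N \<omega> - m\<bar>" by linarith
        then show ?thesis using \<omega> by simp
      next
        case False
        then have "(m / 2)\<^sup>2 \<le> (T N \<omega>)\<^sup>2" using m_pos by (intro power_mono) auto
        then have "(m / 2)\<^sup>2 \<le> V * J N \<omega>" using \<omega>(2) by linarith
        then have "m\<^sup>2 / (4 * V) \<le> J N \<omega>" using V by (simp add: power_divide field_simps)
        then show ?thesis using \<omega> by simp
      qed
    qed
    then have "prob (S N) \<le> prob ({\<omega> \<in> space M. m / 2 \<le> \<bar>T N \<omega> - m\<bar>} \<union> {\<omega> \<in> space M. m\<^sup>2 / (4 * V) \<le> J N \<omega>})"
      by (intro finite_measure_mono) auto
    also have "\<dots> \<le> prob {\<omega> \<in> space M. m / 2 \<le> \<bar>T N \<omega> - m\<bar>} + prob {\<omega> \<in> space M. m\<^sup>2 / (4 * V) \<le> J N \<omega>}"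
      by (intro measure_Un_le) auto
    also have "\<dots> \<le> (7 + 2 * c) * h N / (m / 2)\<^sup>2 + C * real N / (m\<^sup>2 / (4 * V))"
    proof (intro add_mono)
      have "prob {\<omega> \<in> space M. m / 2 \<le> \<bar>T N \<omega> - m\<bar>} \<le> variance (T N) / (m / 2)\<^sup>2"
        unfolding m_def using m_pos T2_int by (intro Chebyshev_inequality) (auto simp: m_def)
      also have "\<dots> \<le> (7 + 2 * c) * h N / (m / 2)\<^sup>2"
        by (intro divide_right_mono var) simp
      finally show "prob {\<omega> \<in> space M. m / 2 \<le> \<bar>T N \<omega> - m\<bar>} \<le> (7 + 2 * c) * h N / (m / 2)\<^sup>2" .
      have "prob {\<omega> \<in> space M. m\<^sup>2 / (4 * V) \<le> J N \<omega>} \<le> expectation (J N) / (m\<^sup>2 / (4 * V))"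
        by (rule integral_Markov_inequality_measure[OF J_int, where A="{}"]) (use m_pos V J_nonneg in auto)
      also have "\<dots> \<le> C * real N / (m\<^sup>2 / (4 * V))"
        using V by (intro divide_right_mono EJ) simp
      finally show "prob {\<omega> \<in> space M. m\<^sup>2 / (4 * V) \<le> J N \<omega>} \<le> C * real N / (m\<^sup>2 / (4 * V))" .
    qed
    also have "\<dots> = (4 * (7 + 2 * c) * h N + 4 * V * C * real N) / m\<^sup>2"
      using m_pos V by (simp add: power_divide field_simps)
    also have "\<dots> \<le> ((4 * (7 + 2 * c) + 8 * V * C) * h N) / (rate * (h N / 2))\<^sup>2"
    proof (intro frac_le)
      have "4 * V * C * real N \<le> 4 * V * C * (2 * h N)"
        using h V C by (intro mult_left_mono) auto
      then show "4 * (7 + 2 * c) * h N + 4 * V * C * real N \<le> (4 * (7 + 2 * c) + 8 * V * C) * h N"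
        by (simp add: algebra_simps)
      show "(rate * (h N / 2))\<^sup>2 \<le> m\<^sup>2" using m_half rate_pos h2 by (intro power_mono) auto
      show "0 < (rate * (h N / 2))\<^sup>2" using rate_pos h2 by simp
      show "0 \<le> (4 * (7 + 2 * c) + 8 * V * C) * h N" using c V C h2 by simp
    qed
    also have "\<dots> = D / h N"
      using h2 rate_pos by (simp add: D_def power2_eq_square)
    also have "\<dots> \<le> D / (real N / 2)"
      using h h2 D N c by (intro divide_left_mono mult_pos_pos) auto
    finally show ?thesis by simp
  qed
  have "prob (\<Inter>N. S N) \<le> 0"
  proof (rule LIMSEQ_le_const)
    show "(\<lambda>N. D * 2 / real N) \<longlonglongrightarrow> 0" by (rule lim_const_over_n)
    obtain N0 :: nat where N0: "4 * c + 2 \<le> real N0" using real_arch_simple by blast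
    have "prob (\<Inter>N. S N) \<le> D * 2 / real N" if "N0 \<le> N" for N
    proof -
      have "prob (\<Inter>N. S N) \<le> prob (S N)" by (intro finite_measure_mono) auto
      also have "\<dots> \<le> D * 2 / real N" using that N0 by (intro bound) (auto intro: order_trans)
      finally show ?thesis .
    qed
    then show "\<exists>N0. \<forall>N\<ge>N0. prob (\<Inter>N. S N) \<le> D * 2 / real N" by blast
  qed
  then have "emeasure M (\<Inter>N. S N) = 0" by (simp add: emeasure_eq_measure measure_le_0_iff)
  then have "AE \<omega> in M. \<omega> \<notin> (\<Inter>N. S N)"
    by (intro AE_not_in) (auto simp: null_sets_def)
  with AE_space show ?thesis
    by eventually_elim (auto simp: S_def T_def J_def not_le)
qed

section \<open>The lower bound along a single path\<close>

abbreviation level_set :: "'a \<Rightarrow> real \<Rightarrow> real set" where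
  "level_set \<omega> x \<equiv> {t. 0 \<le> t \<and> B t \<omega> = x}"

lemma touch_imp_hit:
  assumes cont: "continuous_on {0..} (\<lambda>t. B t \<omega>)" and B0: "B 0 \<omega> = 0"
    and \<omega>: "\<omega> \<in> touch j k" and x: "j \<le> x" "x < j + 1"
  shows "level_set \<omega> x \<inter> {real k..<real k + 1} \<noteq> {}"
proof -
  have b: "j - 1 \<le> B k \<omega>" "B k \<omega> \<le> j" "2 \<le> B (real k + 1) \<omega> - B k \<omega>"
    using \<omega> B0 by (auto simp: touch_def)
  have "continuous_on {real k..real k + 1} (\<lambda>t. B t \<omega>)"
    by (rule continuous_on_subset[OF cont]) auto
  moreover have "B k \<omega> \<le> x" "x \<le> B (real k + 1) \<omega>" using b x by linarith+
  ultimately obtain t where t: "real k \<le> t" "t \<le> real k + 1" "B t \<omega> = x"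
    using IVT'[of "\<lambda>t. B t \<omega>" "real k" x "real k + 1"] by auto
  \<comment> \<open>The jump ends at height at least \<open>j + 1 > x\<close>, so the time found
    lies in the half-open cell.\<close>
  moreover have "t \<noteq> real k + 1" using t(3) b x by auto
  ultimately have "t \<in> level_set \<omega> x \<inter> {real k..<real k + 1}"
    using of_nat_0_le_iff[of k] by (auto intro: order_trans)
  then show ?thesis by blast
qed

text \<open>The energy inequality in each shell is followed by Cauchy-Schwarz over the shells.
  Weights and energies depend on \<open>x\<close> only through \<open>j\<close>, which makes the
  estimate uniform over \<open>[j, j + 1)\<close>.\<close>

lemma weight_squared_le:
  assumes cont: "continuous_on {0..} (\<lambda>t. B t \<omega>)" and B0: "B 0 \<omega> = 0"
    and x: "j \<le> x" "x < j + 1" and \<rho>: "0 \<le> \<sigma>" "\<sigma> \<le> \<rho>"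
  shows "(\<Sum>k=1..<2 ^ N. weight j k \<omega>)\<^sup>2 \<le>
    (\<Sum>n=1..N. macro_nu n \<sigma> (level_set \<omega> x)) * (\<Sum>n=1..N. energy \<rho> j n \<omega>)"
proof -
  define \<mu> where "\<mu> n = (\<Sum>k=2 ^ (n - 1)..<2 ^ n. weight j k \<omega>)" for n
  define \<nu> where "\<nu> n = macro_nu n \<sigma> (level_set \<omega> x)" for n
  have \<mu>0: "0 \<le> \<mu> n" for n unfolding \<mu>_def by (intro sum_nonneg weight_nonneg)
  have block: "(\<mu> n)\<^sup>2 \<le> \<nu> n * energy \<rho> j n \<omega>" if n: "1 \<le> n" for n
  proof -
    \<comment> \<open>The energy inequality asks that all cells meet the level set; unmarked points
      carry weight zero and are left out.\<close>
    define P where "P = {k\<in>{2 ^ (n - 1)..<2 ^ n}. \<omega> \<in> touch j k}"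
    have P: "(\<Sum>k=2 ^ (n - 1)..<2 ^ n. g k) = (\<Sum>k\<in>P. g k)" if "\<And>k. \<omega> \<notin> touch j k \<Longrightarrow> g k = 0" for g :: "nat \<Rightarrow> real"
      using that by (intro sum.mono_neutral_right) (auto simp: P_def)
    have w: "weight j k \<omega> = 0" if "\<omega> \<notin> touch j k" for k using that by (simp add: weight_def)
    have "\<mu> n = (\<Sum>k\<in>P. weight j k \<omega>)" unfolding \<mu>_def by (intro P w)
    moreover have "energy \<rho> j n \<omega> =
        (\<Sum>k\<in>P. \<Sum>l\<in>P. weight j k \<omega> * weight j l \<omega> * (2 ^ n / (\<bar>real k - real l\<bar> + 1)) powr \<rho>)"
    proof -
      have "energy \<rho> j n \<omega> = (\<Sum>k=2 ^ (n - 1)..<2 ^ n. \<Sum>l\<in>P. weight j k \<omega> * weight j l \<omega> * (2 ^ n / (\<bar>real k - real l\<bar> + 1)) powr \<rho>)"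
        unfolding energy_def by (intro sum.cong refl P) (simp add: w)
      also have "\<dots> = (\<Sum>k\<in>P. \<Sum>l\<in>P. weight j k \<omega> * weight j l \<omega> * (2 ^ n / (\<bar>real k - real l\<bar> + 1)) powr \<rho>)"
        by (intro P sum.neutral) (simp add: w)
      finally show ?thesis .
    qed
    moreover have "(\<Sum>k\<in>P. weight j k \<omega>)\<^sup>2 \<le> macro_nu n \<sigma> (level_set \<omega> x) *
        (\<Sum>k\<in>P. \<Sum>l\<in>P. weight j k \<omega> * weight j l \<omega> * (2 ^ n / (\<bar>real k - real l\<bar> + 1)) powr \<rho>)"
      using touch_imp_hit[OF cont B0 _ x] weight_nonneg
      by (intro mass_squared_le_nu_energy n \<rho>) (auto simp: P_def)
    ultimately show ?thesis by (simp add: \<nu>_def)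
  qed
  have \<nu>0: "0 \<le> \<nu> n" if "1 \<le> n" for n using that unfolding \<nu>_def by (rule macro_nu_nonneg)
  have "(\<Sum>k=1..<2 ^ N. weight j k \<omega>) = (\<Sum>n=1..N. \<mu> n)"
    unfolding \<mu>_def by (rule sum_dyadic_blocks)
  also have "\<dots> \<le> (\<Sum>n=1..N. sqrt (\<nu> n) * sqrt (energy \<rho> j n \<omega>))"
  proof (intro sum_mono)
    fix n assume "n \<in> {1..N}"
    then have "sqrt ((\<mu> n)\<^sup>2) \<le> sqrt (\<nu> n * energy \<rho> j n \<omega>)"
      by (intro real_sqrt_le_mono block) auto
    then show "\<mu> n \<le> sqrt (\<nu> n) * sqrt (energy \<rho> j n \<omega>)"
      using \<mu>0 by (simp add: real_sqrt_mult)
  qed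
  finally have "(\<Sum>k=1..<2 ^ N. weight j k \<omega>)\<^sup>2 \<le> (\<Sum>n=1..N. sqrt (\<nu> n) * sqrt (energy \<rho> j n \<omega>))\<^sup>2"
    by (intro power_mono sum_nonneg weight_nonneg)
  also have "\<dots> \<le> (\<Sum>n=1..N. (sqrt (\<nu> n))\<^sup>2) * (\<Sum>n=1..N. (sqrt (energy \<rho> j n \<omega>))\<^sup>2)"
    by (rule Cauchy_Schwarz_ineq_sum)
  also have "\<dots> = (\<Sum>n=1..N. \<nu> n) * (\<Sum>n=1..N. energy \<rho> j n \<omega>)"
    using \<nu>0 energy_nonneg by (intro arg_cong2[where f="(*)"] sum.cong) auto
  finally show ?thesis by (simp add: \<nu>_def)
qed

text \<open>A single null set serves all integers \<open>j\<close>, \<open>m\<close> and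
  \<open>V\<close>. Outside it, a convergent sum bounded by \<open>V\<close> would contradict
  \<open>weight_squared_le\<close> at the \<open>N\<close> supplied by
  \<open>weight_energy_null\<close>.\<close>

lemma AE_not_summable_macro_nu:
  "AE \<omega> in M. \<forall>x \<rho>. 0 \<le> \<rho> \<longrightarrow> \<rho> < 1 / 2 \<longrightarrow> \<not> summable (\<lambda>n. macro_nu (Suc n) \<rho> (level_set \<omega> x))"
proof -
  \<comment> \<open>These exponents increase to one half; the shift by 3 makes already
    \<open>r 0 = 1 / 6\<close> positive.\<close>
  define r where "r m = 1 / 2 - 1 / real (m + 3)" for m :: nat
  have r: "0 < r m" "r m < 1 / 2" for m by (auto simp: r_def field_simps)
  have cont: "AE \<omega> in M. continuous_on {0..} (\<lambda>t. B t \<omega>)" and B0: "AE \<omega> in M. B 0 \<omega> = 0"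
    using BM by (auto simp: standard_BM_def)
  have "AE \<omega> in M. \<forall>j::int. \<forall>m V::nat. \<exists>N. real (Suc V) * (\<Sum>n=1..N. energy (r m) j n \<omega>) < (\<Sum>k=1..<2 ^ N. weight j k \<omega>)\<^sup>2"
    unfolding AE_all_countable by (intro allI weight_energy_null r) simp
  with cont B0 show ?thesis
  proof (eventually_elim, intro allI impI notI)
    fix \<omega> x \<rho>
    assume cont: "continuous_on {0..} (\<lambda>t. B t \<omega>)" and B0: "B 0 \<omega> = 0"
      and beat: "\<forall>j::int. \<forall>m V::nat. \<exists>N. real (Suc V) * (\<Sum>n=1..N. energy (r m) j n \<omega>) < (\<Sum>k=1..<2 ^ N. weight j k \<omega>)\<^sup>2"
      and \<rho>: "0 \<le> \<rho>" "\<rho> < 1 / 2"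
      and sum: "summable (\<lambda>n. macro_nu (Suc n) \<rho> (level_set \<omega> x))"
    define j where "j = \<lfloor>x\<rfloor>"
    have x: "real_of_int j \<le> x" "x < real_of_int j + 1" unfolding j_def by linarith+
    obtain m :: nat where "1 / (1 / 2 - \<rho>) \<le> real m" using real_arch_simple by blast
    then have "1 / (1 / 2 - \<rho>) \<le> real (m + 3)" by simp
    then have "1 / real (m + 3) \<le> 1 / 2 - \<rho>" using \<rho> by (simp add: field_simps)
    then have m: "\<rho> \<le> r m" by (simp add: r_def)
    obtain V :: nat where V: "suminf (\<lambda>n. macro_nu (Suc n) \<rho> (level_set \<omega> x)) \<le> real V"
      using real_arch_simple by blast
    obtain N where N: "real (Suc V) * (\<Sum>n=1..N. energy (r m) j n \<omega>) < (\<Sum>k=1..<2 ^ N. weight j k \<omega>)\<^sup>2"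
      using beat by blast
    have "(\<Sum>n=1..N. macro_nu n \<rho> (level_set \<omega> x)) = (\<Sum>n<N. macro_nu (Suc n) \<rho> (level_set \<omega> x))"
      by (rule sum.reindex_bij_witness[where i=Suc and j="\<lambda>n. n - 1"]) auto
    also have "\<dots> \<le> suminf (\<lambda>n. macro_nu (Suc n) \<rho> (level_set \<omega> x))"
      using sum by (intro sum_le_suminf) (auto intro: macro_nu_nonneg)
    finally have "(\<Sum>n=1..N. macro_nu n \<rho> (level_set \<omega> x)) \<le> real (Suc V)" using V by simp
    then have "(\<Sum>n=1..N. macro_nu n \<rho> (level_set \<omega> x)) * (\<Sum>n=1..N. energy (r m) j n \<omega>) \<le>
        real (Suc V) * (\<Sum>n=1..N. energy (r m) j n \<omega>)"
      by (intro mult_right_mono sum_nonneg energy_nonneg)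
    then show False
      using N weight_squared_le[OF cont B0 x \<rho>(1) m, of N] by linarith
  qed
qed

subsection \<open>Convergence above dimension one half\<close>

text \<open>Off this event the chaining bound keeps the path within \<open>c\<close> of its value at \<open>k\<close> during
  \<open>[k, k + 1)\<close>.\<close>

definition wild :: "real \<Rightarrow> nat \<Rightarrow> 'a set" where
  "wild c k = (\<Union>m. \<Union>i<2 ^ m. {\<omega> \<in> space M.
     c / 8 * (7 / 8) ^ m < \<bar>B (real k + real (Suc i) / 2 ^ m) \<omega> - B (real k + real i / 2 ^ m) \<omega>\<bar>})"

lemma sets_wild [measurable]: "wild c k \<in> sets M"
  unfolding wild_def by measurable

lemma oscillation_le:
  assumes cont: "continuous_on {0..} (\<lambda>t. B t \<omega>)"
    and \<omega>: "\<omega> \<in> space M" "\<omega> \<notin> wild c k" and t: "t \<in> {real k..<real k + 1}"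
  shows "\<bar>B t \<omega> - B k \<omega>\<bar> \<le> c"
proof -
  \<comment> \<open>The constants in \<open>wild\<close> are chosen so that the geometric series
    sums to exactly \<open>c\<close>.\<close>
  have "\<bar>B (real k + (t - real k)) \<omega> - B k \<omega>\<bar> \<le> (c / 8) / (1 - 7 / 8)"
  proof (rule dyadic_chaining)
    show "continuous_on {real k..real k + 1} (\<lambda>t. B t \<omega>)"
      by (rule continuous_on_subset[OF cont]) auto
  qed (use \<omega> t in \<open>auto simp: wild_def not_less\<close>)
  then show ?thesis by simp
qed

text \<open>Since \<open>(1 / 2) / (7 / 8)^2 = 32 / 49\<close>, the tail bound at scale
  \<open>m\<close> decays like \<open>(32 / 49) ^ (p * m)\<close>, and \<open>2 \<le> p\<close>
  makes this at most \<open>(7 / 16) ^ m\<close>. The \<open>2 ^ m\<close> increments then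
  contribute \<open>(7 / 8) ^ m\<close>, whose sum over \<open>m\<close> is the factor 8.\<close>

lemma prob_wild_le:
  assumes c: "0 < c" and p: "2 \<le> p"
  shows "prob (wild c k) \<le> fact (2 * p) / (2 ^ p * fact p) * 64 ^ p * 8 / c ^ (2 * p)"
proof -
  define C where "C = fact (2 * p) / (2 ^ p * fact p) * 64 ^ p / c ^ (2 * p)"
  have C: "0 \<le> C" unfolding C_def using c by simp
  let ?X = "\<lambda>m i. {\<omega> \<in> space M.
     c / 8 * (7 / 8) ^ m < \<bar>B (real k + real (Suc i) / 2 ^ m) \<omega> - B (real k + real i / 2 ^ m) \<omega>\<bar>}"
  let ?U = "\<lambda>m. \<Union>i<2 ^ m. ?X m i"
  have scale: "prob (?U m) \<le> C * (7 / 8) ^ m" for m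
  proof -
    have X: "prob (?X m i) \<le> C * (7 / 16) ^ m" for i
    proof -
      let ?s = "real k + real i / 2 ^ m" and ?t = "real k + real (Suc i) / 2 ^ m"
      have diff: "?t - ?s = (1 / 2) ^ m" by (simp add: add_divide_distrib power_one_over)
      have "0 < (1 / 2 :: real) ^ m" by simp
      then have st: "?s < ?t" unfolding diff[symmetric] by linarith
      have "prob (?X m i) \<le> fact (2 * p) / (2 ^ p * fact p) * (?t - ?s) ^ p / (c / 8 * (7 / 8) ^ m) ^ (2 * p)"
        using c st by (intro prob_increment_tail) auto
      also have "\<dots> = C * ((32 / 49) ^ p) ^ m"
      proof -
        have "((7 / 8 :: real) ^ m)\<^sup>2 = ((7 / 8)\<^sup>2) ^ m"
          by (simp only: power_mult[symmetric] mult.commute)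
        then have "(c / 8 * (7 / 8) ^ m)\<^sup>2 = c\<^sup>2 / 64 * (49 / 64) ^ m"
          by (simp only: power_mult_distrib power_divide) simp
        then have "(c / 8 * (7 / 8) ^ m) ^ (2 * p) = (c\<^sup>2 / 64 * (49 / 64) ^ m) ^ p"
          by (simp only: power_mult)
        also have "\<dots> = c ^ (2 * p) / 64 ^ p * ((49 / 64) ^ m) ^ p"
          by (simp only: power_mult_distrib[of "c\<^sup>2 / 64"] power_divide[of "c\<^sup>2"] power_mult)
        finally have e1: "(c / 8 * (7 / 8) ^ m) ^ (2 * p) = c ^ (2 * p) / 64 ^ p * ((49 / 64) ^ m) ^ p" .
        have "(1 / 2 :: real) ^ m = (32 / 49) ^ m * (49 / 64) ^ m"
          by (simp only: power_mult_distrib[symmetric]) simp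
        then have "((1 / 2 :: real) ^ m) ^ p = ((32 / 49) ^ m) ^ p * ((49 / 64) ^ m) ^ p"
          by (simp only: power_mult_distrib)
        also have "((32 / 49 :: real) ^ m) ^ p = ((32 / 49) ^ p) ^ m"
          by (simp only: power_mult[symmetric] mult.commute)
        finally have e2: "((1 / 2 :: real) ^ m) ^ p = ((32 / 49) ^ p) ^ m * ((49 / 64) ^ m) ^ p" .
        have cancel: "a * (b * z) / (d / e * z) = a * e / d * b" if "z \<noteq> 0" for a b d e z :: real
          using that by simp
        show ?thesis unfolding diff C_def e1 e2 by (rule cancel) simp
      qed
      also have "\<dots> \<le> C * (7 / 16) ^ m"
      proof (intro mult_left_mono power_mono C)
        have "(32 / 49 :: real) ^ p \<le> (32 / 49) ^ 2" by (rule power_decreasing[OF p]) auto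
        also have "\<dots> \<le> 7 / 16" by (simp add: power2_eq_square)
        finally show "(32 / 49 :: real) ^ p \<le> 7 / 16" .
      qed simp
      finally show ?thesis .
    qed
    have "prob (?U m) \<le> (\<Sum>i<2 ^ m. prob (?X m i))"
      by (rule finite_measure_subadditive_finite) auto
    also have "\<dots> \<le> (\<Sum>i<(2::nat) ^ m. C * (7 / 16) ^ m)"
      by (intro sum_mono X)
    also have "\<dots> = C * (2 ^ m * (7 / 16) ^ m)" by simp
    also have "(2 ^ m * (7 / 16) ^ m :: real) = (7 / 8) ^ m"
      by (simp only: power_mult_distrib[symmetric]) simp
    finally show ?thesis .
  qed
  have sum: "summable (\<lambda>m. C * (7 / 8) ^ m)" by (intro summable_mult summable_geometric) simp
  have sumU: "summable (\<lambda>m. prob (?U m))"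
    by (rule summable_comparison_test'[OF sum, of 0]) (use scale in simp)
  have "prob (wild c k) \<le> (\<Sum>m. prob (?U m))"
    unfolding wild_def by (rule finite_measure_subadditive_countably[OF _ sumU]) auto
  also have "\<dots> \<le> (\<Sum>m. C * (7 / 8) ^ m)" by (intro suminf_le scale sumU sum)
  also have "\<dots> = C * 8" by (subst suminf_mult) (auto simp: suminf_geometric summable_geometric)
  finally show ?thesis by (simp add: C_def)
qed

text \<open>A majorant, common to all \<open>x\<close> in \<open>[j, j + 1)\<close>, of the number
  of unit cells met by the level set: in such a cell the path either starts within \<open>c\<close>
  of \<open>[j, j + 1]\<close> or is wild.\<close>

definition cover_count :: "real \<Rightarrow> int \<Rightarrow> nat \<Rightarrow> 'a \<Rightarrow> real" where
  "cover_count c j n \<omega> = (\<Sum>k=2 ^ (n - 1)..<2 ^ n.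
     indicator {\<omega> \<in> space M. B k \<omega> - B 0 \<omega> \<in> {real_of_int j - c..real_of_int j + 1 + c}} \<omega> + indicator (wild c k) \<omega>)"

lemma integrable_cover_count [simp]: "integrable M (cover_count c j n)"
  unfolding cover_count_def by (intro Bochner_Integration.integrable_sum Bochner_Integration.integrable_add integrable_indicator_event) measurable

lemma cover_count_nonneg: "0 \<le> cover_count c j n \<omega>"
  unfolding cover_count_def by (intro sum_nonneg) simp

lemma macro_nu_le_cover_count:
  assumes cont: "continuous_on {0..} (\<lambda>t. B t \<omega>)" and B0: "B 0 \<omega> = 0" and \<omega>: "\<omega> \<in> space M"
    and x: "real_of_int j \<le> x" "x < real_of_int j + 1" and n: "1 \<le> n"
  shows "macro_nu n \<rho> (level_set \<omega> x) \<le> cover_count c j n \<omega> * (1 / 2 ^ n) powr \<rho>"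
proof -
  let ?H = "{k\<in>{2 ^ (n - 1)..<2 ^ n}. level_set \<omega> x \<inter> {real k..<real k + 1} \<noteq> {}}"
  have "real (card ?H) = (\<Sum>k=2 ^ (n - 1)..<2 ^ n. if level_set \<omega> x \<inter> {real k..<real k + 1} \<noteq> {} then 1 else 0)"
    by (simp add: sum.If_cases Int_def)
  also have "\<dots> \<le> cover_count c j n \<omega>"
    unfolding cover_count_def
  proof (intro sum_mono)
    fix k :: nat
    have "B k \<omega> - B 0 \<omega> \<in> {real_of_int j - c..real_of_int j + 1 + c}"
      if "t \<in> level_set \<omega> x \<inter> {real k..<real k + 1}" "\<omega> \<notin> wild c k" for t
    proof -
      have "\<bar>x - B k \<omega>\<bar> \<le> c" using oscillation_le[OF cont \<omega> that(2), of t] that(1) by auto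
      then show ?thesis using B0 x by (simp add: abs_le_iff)
    qed
    then have "\<omega> \<in> wild c k \<or> B k \<omega> - B 0 \<omega> \<in> {real_of_int j - c..real_of_int j + 1 + c}"
      if "level_set \<omega> x \<inter> {real k..<real k + 1} \<noteq> {}"
      using that by blast
    then show "(if level_set \<omega> x \<inter> {real k..<real k + 1} \<noteq> {} then 1 else 0) \<le>
      indicator {\<omega> \<in> space M. B k \<omega> - B 0 \<omega> \<in> {real_of_int j - c..real_of_int j + 1 + c}} \<omega> + (indicator (wild c k) \<omega> :: real)"
    proof (cases "level_set \<omega> x \<inter> {real k..<real k + 1} = {}")
      case False
      then have "\<omega> \<in> wild c k \<or> B k \<omega> - B 0 \<omega> \<in> {real_of_int j - c..real_of_int j + 1 + c}" by fact
      then have "1 \<le> indicator {\<omega> \<in> space M. B k \<omega> - B 0 \<omega> \<in> {real_of_int j - c..real_of_int j + 1 + c}} \<omega> + (indicator (wild c k) \<omega> :: real)"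
        using \<omega> by (auto simp: indicator_def)
      then show ?thesis using False by (simp only: if_True not_False_eq_True)
    qed simp
  qed
  finally have "real (card ?H) * (1 / 2 ^ n) powr \<rho> \<le> cover_count c j n \<omega> * (1 / 2 ^ n) powr \<rho>"
    by (rule mult_right_mono) simp
  with macro_nu_le_count[OF n] show ?thesis by (rule order_trans)
qed

lemma expectation_cover_count_le:
  assumes n: "1 \<le> n" and c: "1 \<le> c" and p: "2 \<le> p"
  shows "expectation (cover_count c j n) \<le>
    2 ^ n * (3 * c / sqrt (2 ^ n) + fact (2 * p) / (2 ^ p * fact p) * 64 ^ p * 8 / c ^ (2 * p))"
proof -
  define K where "K = fact (2 * p) / (2 ^ p * fact p) * 64 ^ p * 8 / c ^ (2 * p)"
  have K: "0 \<le> K" unfolding K_def using c by simp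
  let ?I = "\<lambda>k::nat. {\<omega> \<in> space M. B k \<omega> - B 0 \<omega> \<in> {real_of_int j - c..real_of_int j + 1 + c}}"
  have "expectation (cover_count c j n) = (\<Sum>k=2 ^ (n - 1)..<2 ^ n. prob (?I k) + prob (wild c k))"
    unfolding cover_count_def by simp
  also have "\<dots> \<le> (\<Sum>k\<in>{2 ^ (n - 1)..<2 ^ n::nat}. 3 * c / sqrt (2 ^ n) + K)"
  proof (intro sum_mono add_mono)
    fix k :: nat assume "k \<in> {2 ^ (n - 1)..<2 ^ n}"
    then have "2 ^ n \<le> 2 * k" using n by (cases n) auto
    then have "real (2 ^ n) \<le> real (2 * k)" by (rule of_nat_mono)
    then have k2: "2 ^ n \<le> 2 * real k" by simp
    moreover have "0 < (2::real) ^ n" by simp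
    ultimately have k: "2 ^ n \<le> 2 * real k" "0 < real k" by linarith+
    have "prob (?I k) \<le> ((real_of_int j + 1 + c) - (real_of_int j - c)) / (sqrt (2 * pi) * sqrt (real k - 0))"
      using k c by (intro prob_increment_le) auto
    also have "\<dots> = (1 + 2 * c) / sqrt (pi * (2 * real k))"
      by (simp add: real_sqrt_mult[symmetric] ac_simps)
    \<comment> \<open>Uses \<open>2 ^ n \<le> 2 * k\<close> on the shell, \<open>1 \<le> pi\<close>,
      and \<open>1 + 2 * c \<le> 3 * c\<close>.\<close>
    also have "\<dots> \<le> 3 * c / sqrt (1 * 2 ^ n)"
      using k c pi_gt3 by (intro frac_le real_sqrt_le_mono mult_mono) auto
    finally show "prob (?I k) \<le> 3 * c / sqrt (2 ^ n)" by simp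
    show "prob (wild c k) \<le> K" unfolding K_def using c by (intro prob_wild_le p) simp
  qed
  also have "\<dots> = real (2 ^ n - 2 ^ (n - 1)) * (3 * c / sqrt (2 ^ n) + K)" by simp
  also have "\<dots> \<le> real (2 ^ n) * (3 * c / sqrt (2 ^ n) + K)"
    using c K by (intro mult_right_mono of_nat_mono) auto
  finally show ?thesis by (simp add: K_def)
qed

text \<open>For \<open>s = 2 ^ Suc n\<close> and \<open>c = s powr \<epsilon>\<close> the expected
  count is of order at most \<open>s powr (1 / 2 + \<epsilon>)\<close>. Against the cost
  \<open>s powr (- (1 / 2 + 2 * \<epsilon>))\<close> per cell a geometric series of ratio
  \<open>(1 / 2) powr \<epsilon>\<close> remains.\<close>

lemma AE_summable_cover_count:
  assumes \<epsilon>: "0 < \<epsilon>"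
  shows "AE \<omega> in M. summable (\<lambda>n. cover_count ((2 ^ Suc n) powr \<epsilon>) j (Suc n) \<omega> * (1 / 2 ^ Suc n) powr (1 / 2 + 2 * \<epsilon>))"
proof (rule AE_summable_of_summable_integral)
  \<comment> \<open>The choice \<open>2 * p * \<epsilon> \<ge> 1 / 2\<close> keeps the share of the
    wild cells, \<open>s powr (1 - 2 * p * \<epsilon>)\<close>, below the order of the other cells;
    the added 2 meets the hypothesis of \<open>prob_wild_le\<close>.\<close>
  obtain p0 :: nat where p0: "1 / (4 * \<epsilon>) \<le> real p0" using real_arch_simple by blast
  define p where "p = p0 + 2"
  have p: "2 \<le> p" "1 / 2 \<le> 2 * real p * \<epsilon>"
  proof -
    have "1 / (4 * \<epsilon>) \<le> real p" using p0 by (simp add: p_def)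
    then show "1 / 2 \<le> 2 * real p * \<epsilon>" using \<epsilon> by (simp add: field_simps)
  qed (simp add: p_def)
  define K where "K = fact (2 * p) / (2 ^ p * fact p) * 64 ^ p * (8::real)"
  have K: "0 \<le> K" by (simp add: K_def)
  have bound: "expectation (cover_count ((2 ^ Suc n) powr \<epsilon>) j (Suc n)) * (1 / 2 ^ Suc n) powr (1 / 2 + 2 * \<epsilon>)
      \<le> (3 + K) * ((1 / 2) powr \<epsilon>) ^ Suc n" for n
  proof -
    define s :: real where "s = 2 ^ Suc n"
    have s: "1 \<le> s" "0 < s" unfolding s_def by (auto simp del: power_Suc)
    have c: "1 \<le> s powr \<epsilon>" using s \<epsilon> by (simp add: ge_one_powr_ge_zero)
    have "expectation (cover_count (s powr \<epsilon>) j (Suc n)) \<le> s * (3 * s powr \<epsilon> / sqrt s + K / (s powr \<epsilon>) ^ (2 * p))"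
      using expectation_cover_count_le[OF _ c p(1), of "Suc n" j] unfolding s_def K_def by simp
    also have "\<dots> = 3 * s powr (1 / 2 + \<epsilon>) + K * s powr (1 - 2 * real p * \<epsilon>)"
    proof -
      have "s * (s powr \<epsilon> / sqrt s) = s / sqrt s * s powr \<epsilon>" by simp
      also have "s / sqrt s = s powr (1 / 2)" using s by (simp add: real_div_sqrt powr_half_sqrt)
      finally have e1: "s * (s powr \<epsilon> / sqrt s) = s powr (1 / 2 + \<epsilon>)" by (simp only: powr_add)
      have e2: "s / (s powr \<epsilon>) ^ (2 * p) = s powr (1 - 2 * real p * \<epsilon>)"
        using s by (simp add: powr_diff powr_realpow[symmetric] powr_powr mult.commute)
      have "s * (3 * s powr \<epsilon> / sqrt s + K / (s powr \<epsilon>) ^ (2 * p)) =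
          3 * (s * (s powr \<epsilon> / sqrt s)) + K * (s / (s powr \<epsilon>) ^ (2 * p))"
        by (simp add: distrib_left ac_simps)
      then show ?thesis unfolding e1 e2 .
    qed
    also have "\<dots> \<le> 3 * s powr (1 / 2 + \<epsilon>) + K * s powr (1 / 2 + \<epsilon>)"
      using p(2) s K \<epsilon> by (intro add_left_mono mult_left_mono powr_mono) auto
    finally have "expectation (cover_count (s powr \<epsilon>) j (Suc n)) \<le> (3 + K) * s powr (1 / 2 + \<epsilon>)"
      by (simp add: algebra_simps)
    then have "expectation (cover_count (s powr \<epsilon>) j (Suc n)) * (1 / s) powr (1 / 2 + 2 * \<epsilon>)
        \<le> (3 + K) * s powr (1 / 2 + \<epsilon>) * (1 / s) powr (1 / 2 + 2 * \<epsilon>)"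
      by (rule mult_right_mono) simp
    also have "\<dots> = (3 + K) * s powr ((1 / 2 + \<epsilon>) - (1 / 2 + 2 * \<epsilon>))"
      unfolding powr_diff using s by (simp add: powr_divide)
    also have "s powr ((1 / 2 + \<epsilon>) - (1 / 2 + 2 * \<epsilon>)) = ((1 / 2) powr \<epsilon>) ^ Suc n"
    proof -
      have "((1 / 2) powr \<epsilon>) ^ Suc n = ((1 / 2) ^ Suc n) powr \<epsilon>"
        by (simp only: powr_realpow[symmetric] powr_powr mult.commute powr_gt_zero zero_less_divide_1_iff zero_less_numeral)
      also have "\<dots> = (1 / s) powr \<epsilon>" by (simp add: s_def power_one_over)
      also have "\<dots> = s powr (- \<epsilon>)" using s by (simp add: powr_divide powr_minus_divide)
      finally show ?thesis by simp
    qed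
    finally show ?thesis by (simp add: s_def)
  qed
  have "summable (\<lambda>n. (3 + K) * ((1 / 2) powr \<epsilon>) ^ n)"
    using \<epsilon> by (intro summable_mult summable_geometric) (simp add: powr_divide)
  then have "summable (\<lambda>n. (3 + K) * ((1 / 2) powr \<epsilon>) ^ Suc n)"
    by (subst summable_Suc_iff)
  then show "summable (\<lambda>n. expectation (\<lambda>\<omega>. cover_count ((2 ^ Suc n) powr \<epsilon>) j (Suc n) \<omega> * (1 / 2 ^ Suc n) powr (1 / 2 + 2 * \<epsilon>)))"
    by (rule summable_comparison_test'[where N=0])
      (use bound in \<open>simp add: abs_mult Bochner_Integration.integral_nonneg cover_count_nonneg del: power_Suc\<close>)
qed (auto intro!: mult_nonneg_nonneg cover_count_nonneg)

text \<open>The null set is a countable union over \<open>j\<close> and \<open>m\<close>; a real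
  \<open>x\<close> is then handled through \<open>j = \<lfloor>x\<rfloor>\<close>. The value of
  \<open>\<epsilon> m\<close> makes \<open>2 * \<epsilon> m\<close> equal to the excess over one
  half in \<open>macro_DimH_eqI\<close>.\<close>

lemma AE_summable_macro_nu:
  "AE \<omega> in M. \<forall>x m. summable (\<lambda>n. macro_nu (Suc n) (1 / 2 + 1 / real (Suc m)) (level_set \<omega> x))"
proof -
  define \<epsilon> where "\<epsilon> m = 1 / (2 * real (Suc m))" for m
  have "AE \<omega> in M. continuous_on {0..} (\<lambda>t. B t \<omega>)" and "AE \<omega> in M. B 0 \<omega> = 0"
    using BM by (auto simp: standard_BM_def)
  moreover have "AE \<omega> in M. \<forall>j::int. \<forall>m. summable (\<lambda>n. cover_count ((2 ^ Suc n) powr \<epsilon> m) j (Suc n) \<omega> * (1 / 2 ^ Suc n) powr (1 / 2 + 2 * \<epsilon> m))"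
    unfolding AE_all_countable by (intro allI AE_summable_cover_count) (simp add: \<epsilon>_def)
  ultimately show ?thesis
    using AE_space
  proof (eventually_elim, intro allI)
    fix \<omega> and x :: real and m
    assume cont: "continuous_on {0..} (\<lambda>t. B t \<omega>)" and B0: "B 0 \<omega> = 0" and \<omega>: "\<omega> \<in> space M"
      and sum: "\<forall>j::int. \<forall>m. summable (\<lambda>n. cover_count ((2 ^ Suc n) powr \<epsilon> m) j (Suc n) \<omega> * (1 / 2 ^ Suc n) powr (1 / 2 + 2 * \<epsilon> m))"
    define j where "j = \<lfloor>x\<rfloor>"
    have x: "real_of_int j \<le> x" "x < real_of_int j + 1" unfolding j_def by linarith+
    have "summable (\<lambda>n. macro_nu (Suc n) (1 / 2 + 2 * \<epsilon> m) (level_set \<omega> x))"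
    proof (rule summable_comparison_test'[where N=0])
      show "summable (\<lambda>n. cover_count ((2 ^ Suc n) powr \<epsilon> m) j (Suc n) \<omega> * (1 / 2 ^ Suc n) powr (1 / 2 + 2 * \<epsilon> m))"
        using sum by blast
      fix n
      have "0 \<le> macro_nu (Suc n) (1 / 2 + 2 * \<epsilon> m) (level_set \<omega> x)" by (rule macro_nu_nonneg) simp
      moreover have "macro_nu (Suc n) (1 / 2 + 2 * \<epsilon> m) (level_set \<omega> x) \<le>
          cover_count ((2 ^ Suc n) powr \<epsilon> m) j (Suc n) \<omega> * (1 / 2 ^ Suc n) powr (1 / 2 + 2 * \<epsilon> m)"
        by (rule macro_nu_le_cover_count[OF cont B0 \<omega> x]) simp
      ultimately show "norm (macro_nu (Suc n) (1 / 2 + 2 * \<epsilon> m) (level_set \<omega> x)) \<le>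
          cover_count ((2 ^ Suc n) powr \<epsilon> m) j (Suc n) \<omega> * (1 / 2 ^ Suc n) powr (1 / 2 + 2 * \<epsilon> m)"
        by simp
    qed
    moreover have "2 * \<epsilon> m = 1 / real (Suc m)" by (simp add: \<epsilon>_def del: of_nat_Suc)
    ultimately show "summable (\<lambda>n. macro_nu (Suc n) (1 / 2 + 1 / real (Suc m)) (level_set \<omega> x))"
      by simp
  qed
qed

end

theorem theorem2:
  fixes M :: "'a measure" and B :: "real \<Rightarrow> 'a \<Rightarrow> real"
  assumes "standard_BM M B"
  shows "AE \<omega> in M. \<forall>x::real. macro_DimH {t. 0 \<le> t \<and> B t \<omega> = x} = 1 / 2"
proof -
  interpret brownian_motion M B by unfold_locales fact
  show ?thesis
    using AE_summable_macro_nu AE_not_summable_macro_nu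
  proof eventually_elim
    case (elim \<omega>)
    then show ?case by (intro allI macro_DimH_eqI) auto
  qed
qed

end
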